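(* For any finite or countably infinite alphabet $\mathcal X$, any distribution $p$ over $\mathcal X$ and any positive integer $n$, let $\Phi^n\sim p$ be the profile of an i.i.d. sample $X^n\sim p$, let $H(\Phi^n)$ be its Shannon entropy, and let $\mathcal D(\Phi^n)$ be its dimension. Then with probability at least $1-\mathcal O(1/\sqrt n)$, \[ \lceil H(\Phi^n)\rceil=\tilde\Theta(\mathcal D(\Phi^n)), \] where $\tilde\Theta(\cdot)$ hides logarithmic factors of $n$.
   Context: For a sequence $x^n$ over $\mathcal X$, the multiplicity $\mu_y(x^n)$ of a symbol $y$ is the number of times $y$ appears in $x^n$. The profile $\varphi(x^n)$ of $x^n$ is the multiset of multiplicities of the symbols appearing in $x^n$. The dimension $\mathcal D(S)$ of a multiset $S$ is the number of distinct elements of $S$. For $X^n$ an i.i.d. sample from $p$, the random multiset $\Phi^n:=\varphi(X^n)$ has a distribution depending only on $p$ and $n$; one writes $\Phi^n\sim p$. $H(\Phi^n)$ is the (deterministic) Shannon entropy of the random variable $\Phi^n$, called the profile entropy, while $\mathcal D(\Phi^n)$ is a random variable. $\lceil x\rceil$ denotes the smallest integer larger than $x$. $\mathcal O$ hides an absolute constant; $A=\tilde\Theta(B)$ means that $B/(C(1+\log n)^{C})\le A\le C(1+\log n)^{C}B$ for an absolute constant $C$. All constants are independent of $p$, $n$ and $\mathcal X$. *)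

theory Defs
  imports "HOL-Probability.Probability"
begin

definition profile :: "'a list \<Rightarrow> nat multiset" where
  "profile xs = image_mset (count_list xs) (mset_set (set xs))"

definition mset_dimension :: "'b multiset \<Rightarrow> nat" where
  "mset_dimension S = card (set_mset S)"

text \<open>An i.i.d. sample of size \<open>n\<close> from \<open>p\<close> is a random list with law \<^term>\<open>replicate_pmf n p\<close>.
  Every \<open>pmf\<close> has countable support, so \<open>'a pmf\<close> consists of the distributions on the finite or
  countably infinite alphabets whose symbols have type \<open>'a\<close>. Entropies are in nats.\<close>

definition profile_entropy :: "nat \<Rightarrow> 'a pmf \<Rightarrow> real" where
  "profile_entropy n p =
     prob_space.entropy (measure_pmf (replicate_pmf n p)) (exp 1) (count_space UNIV) profile"

text \<open>The smallest integer strictly larger than \<open>x\<close>, which is not the library's \<open>ceiling\<close> when \<open>x\<close>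
  is an integer. The difference matters: if \<open>p\<close> is a point mass, the profile entropy is 0 and the
  dimension of the profile is 1, so the lower bound below fails with \<open>ceiling\<close>.\<close>

definition next_int :: "real \<Rightarrow> int" where
  "next_int x = (LEAST k. x < real_of_int k)"

text \<open>\<open>tilde_Theta C n A B\<close> expresses \<open>A = \<Theta>~(B)\<close>, up to logarithmic factors of \<open>n\<close>,
  with hidden constant \<open>C\<close>.\<close>

definition tilde_Theta :: "real \<Rightarrow> nat \<Rightarrow> real \<Rightarrow> real \<Rightarrow> bool" where
  "tilde_Theta C n A B \<longleftrightarrow>
     B / (C * (1 + ln (real n)) powr C) \<le> A \<and> A \<le> C * (1 + ln (real n)) powr C * B"

definition entropy_dimension_whp :: "real \<Rightarrow> real \<Rightarrow> nat \<Rightarrow> 'a pmf \<Rightarrow> bool" where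
  "entropy_dimension_whp C c n p \<longleftrightarrow>
     measure_pmf.prob (replicate_pmf n p)
       {xs. tilde_Theta C n (next_int (profile_entropy n p)) (mset_dimension (profile xs))}
     \<ge> 1 - c / sqrt (real n)"

text \<open>The constants have to be the same for all alphabets, but HOL cannot quantify over types below
  an existential quantifier: in \<open>\<exists>C c. \<forall>p :: 'a pmf. \<dots>\<close> they could depend on \<open>'a\<close>. A theorem
  about \<open>entropy_dimension_whp\<close> therefore obtains constants from the fixed type \<open>nat\<close>,
  and asserts that whatever constants work there also work for an arbitrary type \<open>'a\<close>.\<close>

lemma next_int_eq: "next_int x = \<lfloor>x\<rfloor> + 1"
  unfolding next_int_def by (rule Least_equality) linarith+

lemma profile_entropy_eq:
  "profile_entropy n p =
     - (\<Sum>\<^sub>\<infinity>\<phi>. pmf (map_pmf profile (replicate_pmf n p)) \<phi> *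
                ln (pmf (map_pmf profile (replicate_pmf n p)) \<phi>))"
proof -
  let ?q = "map_pmf profile (replicate_pmf n p)"
  interpret S: sigma_finite_measure "count_space (UNIV :: nat multiset set)"
  proof (rule sigma_finite_measure_count_space_countable)
    have "(UNIV :: nat multiset set) = range mset"
      by (metis ex_mset surj_def)
    thus "countable (UNIV :: nat multiset set)"
      by (metis countable_image countableI_type)
  qed
  have d: "distr (measure_pmf (replicate_pmf n p)) (count_space UNIV) profile = 
      density (count_space UNIV) (\<lambda>x. ennreal (pmf ?q x))"
    by (subst map_pmf_rep_eq[symmetric], subst measure_pmf_eq_density) simp
  have "KL_divergence (exp 1) (count_space UNIV) (density (count_space UNIV) (\<lambda>x. ennreal (pmf ?q x)))
     = (\<integral>x. pmf ?q x * log (exp 1) (pmf ?q x) \<partial>count_space UNIV)"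
    by (rule S.KL_density) auto
  also have "\<dots> = (\<integral>x. pmf ?q x * ln (pmf ?q x) \<partial>count_space UNIV)"
    by (simp add: log_def)
  finally have *: "profile_entropy n p = - (\<integral>x. pmf ?q x * ln (pmf ?q x) \<partial>count_space UNIV)"
    unfolding profile_entropy_def
    by (simp add: prob_space.entropy_def[OF prob_space_measure_pmf] d)
  have fin: "finite (set_pmf ?q)"
  proof (rule finite_subset)
    have "profile xs \<in> (\<lambda>xs. mset xs) ` {ys. set ys \<subseteq> {..n} \<and> length ys \<le> n}"
      if "length xs = n" for xs :: "'a list"
    proof -
      obtain ys where ys: "mset ys = profile xs" using ex_mset by blast
      have "set ys = set_mset (profile xs)" using ys by (metis set_mset_mset)
      hence "set ys \<subseteq> {..n}"
        using that by (auto simp: profile_def count_le_length)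
      moreover have "length ys = card (set xs)"
        using arg_cong[OF ys, of size] by (simp add: profile_def)
      ultimately show ?thesis using that ys card_length[of xs] by force
    qed
    thus "set_pmf ?q \<subseteq> (\<lambda>xs. mset xs) ` {ys. set ys \<subseteq> {..n} \<and> length ys \<le> n}"
      by (auto simp: set_replicate_pmf)
    show "finite ((\<lambda>xs. mset xs) ` {ys. set ys \<subseteq> {..n} \<and> length ys \<le> n})"
      by (intro finite_imageI finite_lists_length_le) auto
  qed
  have "(\<integral>x. pmf q x * ln (pmf q x) \<partial>count_space UNIV) = (\<Sum>\<^sub>\<infinity>x. pmf q x * ln (pmf q x))"
    if fin: "finite (set_pmf q)" for q :: "nat multiset pmf"
  proof -
    have supp: "x \<in> set_pmf q" if "pmf q x \<noteq> 0" for x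
      using that by (simp add: set_pmf_iff)
    have "(\<integral>x. pmf q x * ln (pmf q x) \<partial>count_space UNIV) = (\<Sum>x\<in>set_pmf q. pmf q x * ln (pmf q x))"
      by (rule lebesgue_integral_count_space_finite_support[THEN trans])
         (auto intro!: finite_subset[OF _ fin] sum.mono_neutral_left supp simp: fin)
    also have "\<dots> = (\<Sum>\<^sub>\<infinity>x. pmf q x * ln (pmf q x))"
      by (subst infsum_finite[symmetric, OF fin], rule infsum_cong_neutral) (auto intro: supp)
    finally show ?thesis .
  qed
  from this[OF fin] show ?thesis using * by simp
qed

end

theory Submission
  imports Defs
begin

text \<open>
  Up to a factor \<open>e n\<close>, the probability of any event about the counts of finitely many symbols is at
  most its probability when these counts are independent Poisson variables with means \<open>n p(x)\<close>.

  Only the symbols with \<open>n p(x) \<ge> 16 L\<close>, where \<open>L = 1 + ln n\<close>, matter, since all others have counts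
  \<open>O(L)\<close> with high probability. For independent counts, the events that a given value is attained are
  negatively dependent. Hence the number of distinct values concentrates around its mean \<open>\<mu>\<close>, and
  the dimension is \<open>\<mu>\<close> up to constant factors and terms \<open>O(L)\<close>.

  The entropy is at most \<open>1 + 2 ln n\<close> times the expected dimension by Gibbs' inequality, as a
  profile of dimension \<open>d\<close> is described by \<open>d\<close> pairs of numbers up to \<open>n\<close>. For the lower bound, group the
  possible counts into slots \<open>{2t, 2t + 1}\<close> and choose one symbol in each occupied slot. Flipping
  the lowest bit of the count of any subset of the chosen symbols changes the Poisson probability by a
  bounded factor per flip, and the original counts can be recovered from the flipped ones and the
  profile. Hence every profile of dimension \<open>d\<close> has probability at most \<open>exp (O(L) - d / 12)\<close>,
  except for a part of the probability space of measure \<open>O(1 / n)\<close>, and so the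
  entropy is of order at least \<open>\<mu> - O(L)\<close>.
\<close>

subsection \<open>Counts and Poisson weights\<close>

definition poi :: "real \<Rightarrow> nat \<Rightarrow> real" where
  "poi l k = exp (- l) * l ^ k / fact k"

lemma poi_nonneg: "l \<ge> 0 \<Longrightarrow> poi l k \<ge> 0"
  by (simp add: poi_def)

lemma power_div_fact_sums: "(\<lambda>k. l ^ k / fact k) sums exp (l :: real)"
  using exp_converges[of l] by (simp add: divide_inverse mult.commute)

lemma power_div_fact_le_exp:
  assumes "l \<ge> (0::real)" shows "l ^ k / fact k \<le> exp l"
  using sum_le_suminf[OF sums_summable[OF power_div_fact_sums[of l]], of "{k}"]
    sums_unique[OF power_div_fact_sums[of l]] assms by simp

lemma sum_poi_le_1:
  assumes "l \<ge> 0" "finite A" shows "(\<Sum>k\<in>A. poi l k) \<le> 1"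
proof -
  have "(\<Sum>k\<in>A. l ^ k / fact k) \<le> exp l"
    using sum_le_suminf[OF sums_summable[OF power_div_fact_sums[of l]], of A]
      sums_unique[OF power_div_fact_sums[of l]] assms by simp
  hence "exp (-l) * (\<Sum>k\<in>A. l ^ k / fact k) \<le> exp (-l) * exp l" by (intro mult_left_mono) auto
  thus ?thesis by (simp add: poi_def sum_distrib_left mult_exp_exp)
qed

text \<open>Chernoff's method for a single weight: split \<open>l ^ k\<close> as
  \<open>y ^ k * (l / y) ^ k\<close> and bound the second factor over \<open>fact k\<close> by the
  exponential series. The two tail bounds below choose \<open>y\<close>.\<close>

lemma poi_le:
  assumes "l \<ge> 0" "y > 0" shows "poi l k \<le> y ^ k * exp (l / y - l)"
proof -
  have "poi l k = exp (-l) * y ^ k * ((l / y) ^ k / fact k)"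
    using assms by (simp add: poi_def power_divide)
  also have "\<dots> \<le> exp (-l) * y ^ k * exp (l / y)"
    using assms by (intro mult_left_mono power_div_fact_le_exp) auto
  also have "\<dots> = y ^ k * exp (l / y - l)" by (simp add: exp_diff exp_minus field_simps)
  finally show ?thesis .
qed

lemma poi_Suc: "poi l (Suc k) = l / real (Suc k) * poi l k"
  by (simp add: poi_def)

lemma poi_upper_tail:
  assumes "l \<ge> 0" shows "poi l k \<le> exp (2 * l - real k)"
proof -
  \<comment> \<open>The choice \<open>y = 1 / e\<close> gives the exponent
    \<open>l * (e - 1) - k\<close>; then \<open>e <= 3\<close>.\<close>
  have "poi l k \<le> exp (-1) ^ k * exp (l / exp (-1) - l)" using assms by (intro poi_le) auto
  also have "\<dots> = exp (l * (exp 1 - 1) - real k)"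
    by (subst exp_of_nat_mult[symmetric], subst mult_exp_exp) (simp add: exp_minus field_simps)
  also have "\<dots> \<le> exp (l * 2 - real k)" using assms exp_le
    by (intro iffD2[OF exp_le_cancel_iff] diff_right_mono mult_left_mono) auto
  finally show ?thesis by (simp add: mult.commute)
qed

lemma poi_lower_tail:
  assumes "l \<ge> 0" shows "poi l k \<le> exp (real k - l / 2)"
proof -
  \<comment> \<open>Here \<open>y = 2\<close>, and \<open>2 <= e\<close> makes the bound a pure
    exponential.\<close>
  have "poi l k \<le> 2 ^ k * exp (l / 2 - l)" using assms by (intro poi_le) auto
  also have "\<dots> \<le> exp 1 ^ k * exp (l / 2 - l)"
    using exp_ge_add_one_self[of 1] by (intro mult_right_mono power_mono) auto
  also have "\<dots> = exp (real k - l / 2)"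
    by (simp add: exp_of_nat_mult[symmetric] mult_exp_exp)
  finally show ?thesis .
qed

text \<open>A weak form of Stirling's bound. The induction step needs
  \<open>e * n ^ (n + 1) <= (n + 1) ^ (n + 1)\<close>, which is \<open>1 + t <= exp t\<close> at
  \<open>t = - 1 / (n + 1)\<close>, raised to the power \<open>n + 1\<close>.\<close>

lemma fact_mult_exp_le:
  assumes "n \<ge> 1" shows "fact n * exp (real n) \<le> exp 1 * real n * real n ^ n"
  using assms
proof (induction n rule: dec_induct)
  case base
  show ?case by simp
next
  case (step n)
  have n: "real n > 0" using step by simp
  have "1 + (- 1 / (real n + 1)) \<le> exp (- 1 / (real n + 1))" by (rule exp_ge_add_one_self)
  hence "real n / (real n + 1) \<le> exp (- 1 / (real n + 1))" by (simp add: field_simps)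
  hence "(real n / (real n + 1)) ^ Suc n \<le> exp (- 1 / (real n + 1)) ^ Suc n"
    by (intro power_mono) auto
  also have "\<dots> = exp (real (Suc n) * (- 1 / (real n + 1)))" by (rule exp_of_nat_mult[symmetric])
  also have "real (Suc n) * (- 1 / (real n + 1)) = -1" by (simp add: field_simps)
  finally have "real n ^ Suc n / (real n + 1) ^ Suc n \<le> 1 / exp 1"
    by (simp only: power_divide exp_minus inverse_eq_divide)
  hence "real n ^ Suc n * exp 1 \<le> (real n + 1) ^ Suc n"
    using n by (simp add: pos_divide_le_eq pos_le_divide_eq divide_le_eq zero_less_mult_iff add_pos_pos del: power_Suc)
  hence *: "exp 1 * (real n * real n ^ n) \<le> real (Suc n) ^ Suc n" by (simp add: algebra_simps)
  have "fact (Suc n) * exp (real (Suc n)) = real (Suc n) * exp 1 * (fact n * exp (real n))"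
    by (simp add: exp_add algebra_simps)
  also have "\<dots> \<le> real (Suc n) * exp 1 * (exp 1 * (real n * real n ^ n))"
    using step.IH by (intro mult_left_mono) (auto simp: mult_ac)
  also have "\<dots> \<le> real (Suc n) * exp 1 * real (Suc n) ^ Suc n"
    using * by (intro mult_left_mono) auto
  finally show ?case by (simp only: mult_ac)
qed

text \<open>The multinomial formula with all symbols outside \<open>S\<close> merged into one class.
  The induction conditions on the first symbol, which lowers one entry of \<open>a\<close>, so
  \<open>a\<close> is kept arbitrary.\<close>

lemma prob_counts_replicate_pmf:
  fixes p :: "'a pmf"
  assumes S: "finite S"
  shows "measure_pmf.prob (replicate_pmf n p) {xs. \<forall>x\<in>S. count_list xs x = a x} =
    (if sum a S \<le> n then fact n * (\<Prod>x\<in>S. pmf p x ^ a x / fact (a x)) *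
        (measure_pmf.prob p (- S) ^ (n - sum a S) / fact (n - sum a S)) else 0)"
proof (induction n arbitrary: a)
  case 0
  show ?case using S by (auto simp: indicator_def sum_eq_0_iff)
next
  case (Suc n)
  define s where "s = measure_pmf.prob p (- S)"
  define W where "W a = (\<Prod>x\<in>S. pmf p x ^ a x / fact (a x))" for a :: "'a \<Rightarrow> nat"
  define P where "P n a = measure_pmf.prob (replicate_pmf n p) {xs. \<forall>x\<in>S. count_list xs x = a x}"
    for n and a :: "'a \<Rightarrow> nat"
  have IH: "P n a = (if sum a S \<le> n then fact n * W a * (s ^ (n - sum a S) / fact (n - sum a S)) else 0)" for a
    unfolding P_def W_def s_def by (rule Suc.IH)
  \<comment> \<open>The conditional probability of the event when the first symbol is
    \<open>y\<close>.\<close>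
  define f where "f y = (if y \<in> S then (if a y = 0 then 0 else P n (a(y := a y - 1))) else P n a)" for y
  have ev: "measure_pmf.prob (replicate_pmf n p) {xs. \<forall>x\<in>S. count_list (y # xs) x = a x} = f y" for y
  proof (cases "y \<in> S")
    case True
    show ?thesis
    proof (cases "a y = 0")
      case a0: True
      hence e: "{xs. \<forall>x\<in>S. count_list (y # xs) x = a x} = {}" using True by force
      show ?thesis unfolding e using True a0 by (simp add: f_def)
    next
      case False
      have "{xs. \<forall>x\<in>S. count_list (y # xs) x = a x} =
            {xs. \<forall>x\<in>S. count_list xs x = (a(y := a y - 1)) x}" using False True by fastforce
      thus ?thesis using True False by (simp add: f_def P_def)
    qed
  next
    case False
    hence "{xs. \<forall>x\<in>S. count_list (y # xs) x = a x} = {xs. \<forall>x\<in>S. count_list xs x = a x}" by auto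
    thus ?thesis using False by (simp add: f_def P_def)
  qed
  have f01: "0 \<le> f y" "f y \<le> 1" for y unfolding ev[symmetric] by auto
  have "P (Suc n) a = measure_pmf.expectation p (\<lambda>y. f y)"
  proof -
    have "replicate_pmf (Suc n) p = bind_pmf p (\<lambda>y. map_pmf ((#) y) (replicate_pmf n p))"
      by (simp add: map_pmf_def)
    hence "ennreal (P (Suc n) a) = (\<integral>\<^sup>+y. ennreal (f y) \<partial>measure_pmf p)"
      unfolding P_def ev[symmetric] measure_pmf.emeasure_eq_measure[symmetric]
      by (simp add: emeasure_bind_pmf vimage_def)
    also have "\<dots> = ennreal (measure_pmf.expectation p f)"
      using f01 by (intro nn_integral_eq_integral measure_pmf.integrable_const_bound[where B=1]) auto
    finally show ?thesis
      using f01 by (simp add: P_def Bochner_Integration.integral_nonneg)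
  qed
  also have "(\<lambda>y. f y) = (\<lambda>y. (\<Sum>x\<in>S. f x * indicator {x} y) + P n a * indicator (- S) y)"
  proof
    fix y
    show "f y = (\<Sum>x\<in>S. f x * indicator {x} y) + P n a * indicator (- S) y"
    proof (cases "y \<in> S")
      case True
      have "(\<Sum>x\<in>S. f x * indicator {x} y) = (\<Sum>x\<in>S. if x = y then f x else 0)"
        by (intro sum.cong) (auto simp: indicator_def)
      thus ?thesis using True S by simp
    next
      case False
      hence "(\<Sum>x\<in>S. f x * indicator {x} y) = 0" by (intro sum.neutral) (auto simp: indicator_def)
      thus ?thesis using False by (simp add: f_def)
    qed
  qed
  also have "measure_pmf.expectation p (\<lambda>y. (\<Sum>x\<in>S. f x * indicator {x} y) + P n a * indicator (- S) y)
     = (\<Sum>x\<in>S. f x * pmf p x) + P n a * s"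
  proof -
    have i: "integrable (measure_pmf p) (\<lambda>y. r * indicator A y :: real)" for r A
      by (intro integrable_mult_right measure_pmf.integrable_const_bound[where B=1])
         (auto simp: indicator_def)
    show ?thesis
      using i by (simp add: Bochner_Integration.integral_add Bochner_Integration.integral_sum
          Bochner_Integration.integrable_sum s_def pmf.rep_eq)
  qed
  finally have rec: "P (Suc n) a = (\<Sum>x\<in>S. f x * pmf p x) + P n a * s" .
  show ?case unfolding P_def[symmetric] W_def[symmetric] s_def[symmetric]
  proof (cases "sum a S \<le> Suc n")
    case True
    \<comment> \<open>The number of draws outside \<open>S\<close>. A first symbol \<open>x\<close>
      in \<open>S\<close> contributes \<open>a x\<close> times a common factor, and a first symbol
      outside \<open>S\<close> contributes \<open>m\<close> times it; these multiplicities add up to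
      \<open>Suc n\<close>.\<close>
    define m where "m = Suc n - sum a S"
    have t1: "f x * pmf p x = real (a x) * (fact n * W a * (s ^ m / fact m))" if x: "x \<in> S" for x
    proof (cases "a x = 0")
      case True
      thus ?thesis using x by (simp add: f_def)
    next
      case False
      let ?b = "a(x := a x - 1)"
      have sb: "sum a S = Suc (sum ?b S)"
        using x S False by (simp add: sum.remove[of S x] cong: sum.cong_simp)
      have Wb: "W ?b * pmf p x = real (a x) * W a"
      proof -
        obtain j where j: "a x = Suc j" using False by (cases "a x") auto
        have Wb: "W ?b = (pmf p x ^ j / fact j) * (\<Prod>y\<in>S-{x}. pmf p y ^ a y / fact (a y))"
          unfolding W_def using x S j by (simp add: prod.remove[of S x] cong: prod.cong_simp)
        have Wa: "W a = (pmf p x ^ Suc j / fact (Suc j)) * (\<Prod>y\<in>S-{x}. pmf p y ^ a y / fact (a y))"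
          unfolding W_def using x S j by (simp add: prod.remove[of S x])
        show ?thesis unfolding Wa Wb unfolding j by (simp add: field_simps del: of_nat_Suc)
      qed
      have "n - sum ?b S = m" "sum ?b S \<le> n" using sb True by (auto simp: m_def)
      hence "f x * pmf p x = fact n * (W ?b * pmf p x) * (s ^ m / fact m)"
        using x False by (simp add: f_def IH)
      thus ?thesis unfolding Wb by simp
    qed
    have t2: "P n a * s = real m * (fact n * W a * (s ^ m / fact m))"
    proof (cases m)
      case 0
      hence "\<not> sum a S \<le> n" using True by (simp add: m_def)
      thus ?thesis using 0 by (simp add: IH)
    next
      case (Suc j)
      hence "sum a S \<le> n" "n - sum a S = j" using True by (auto simp: m_def)
      thus ?thesis using Suc by (simp add: IH field_simps del: of_nat_Suc)
    qed
    have "(\<Sum>x\<in>S. f x * pmf p x) = real (sum a S) * (fact n * W a * (s ^ m / fact m))"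
      unfolding of_nat_sum sum_distrib_right by (intro sum.cong refl t1)
    hence "P (Suc n) a = (real (sum a S) + real m) * (fact n * W a * (s ^ m / fact m))"
      unfolding rec t2 by (simp only: distrib_right)
    also have "real (sum a S) + real m = real (Suc n)" using True by (simp add: m_def)
    finally show "P (Suc n) a = (if sum a S \<le> Suc n then fact (Suc n) * W a *
        (s ^ (Suc n - sum a S) / fact (Suc n - sum a S)) else 0)"
      using True by (simp add: m_def)
  next
    case False
    have "f x = 0" if x: "x \<in> S" for x
    proof (cases "a x = 0")
      case nz: False
      have "sum a S = Suc (sum (a(x := a x - 1)) S)"
        using x S nz by (simp add: sum.remove[of S x] cong: sum.cong_simp)
      thus ?thesis using x nz False by (simp add: f_def IH)
    qed (use x in \<open>simp add: f_def\<close>)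
    thus "P (Suc n) a = (if sum a S \<le> Suc n then fact (Suc n) * W a *
        (s ^ (Suc n - sum a S) / fact (Suc n - sum a S)) else 0)"
      unfolding rec using False by (simp add: IH)
  qed
qed

text \<open>The class outside \<open>S\<close> is removed by bounding its factor by
  \<open>exp (n * s)\<close>. As \<open>n * s\<close> is \<open>n\<close> minus the sum of the
  means, this supplies the factors \<open>exp (- l x)\<close> of the Poisson weights, and Stirling's
  bound turns the remaining \<open>fact n * exp n / n ^ n\<close> into \<open>e * n\<close>.\<close>

lemma prob_counts_le_poi:
  fixes p :: "'a pmf"
  assumes S: "finite S" and n: "n \<ge> 1"
  shows "measure_pmf.prob (replicate_pmf n p) {xs. \<forall>x\<in>S. count_list xs x = a x}
    \<le> exp 1 * real n * (\<Prod>x\<in>S. poi (real n * pmf p x) (a x))"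
proof (cases "sum a S \<le> n")
  case True
  define m where "m = n - sum a S"
  define s where "s = measure_pmf.prob p (- S)"
  define l where "l x = real n * pmf p x" for x
  have s: "s = 1 - (\<Sum>x\<in>S. pmf p x)"
    unfolding s_def using measure_pmf.prob_compl[of S p] S
    by (simp add: measure_measure_pmf_finite Compl_eq_Diff_UNIV)
  have nn: "real n ^ n = (\<Prod>x\<in>S. real n ^ a x) * real n ^ m"
    using True by (simp add: power_sum[symmetric] power_add[symmetric] m_def)
  have "real n ^ n * (measure_pmf.prob (replicate_pmf n p) {xs. \<forall>x\<in>S. count_list xs x = a x})
      = fact n * (\<Prod>x\<in>S. l x ^ a x / fact (a x)) * ((real n * s) ^ m / fact m)"
    unfolding prob_counts_replicate_pmf[OF S] nn l_def using True
    by (simp add: m_def s_def prod.distrib power_mult_distrib prod_dividef)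
  also have "\<dots> \<le> fact n * (\<Prod>x\<in>S. l x ^ a x / fact (a x)) * exp (real n * s)"
    by (intro mult_left_mono power_div_fact_le_exp mult_nonneg_nonneg prod_nonneg) (auto simp: s_def l_def)
  also have "exp (real n * s) = exp (real n) * (\<Prod>x\<in>S. exp (- l x))"
    unfolding exp_sum[OF S, symmetric] mult_exp_exp
    by (simp add: s l_def sum_negf sum_distrib_left algebra_simps)
  also have "fact n * (\<Prod>x\<in>S. l x ^ a x / fact (a x)) * (exp (real n) * (\<Prod>x\<in>S. exp (- l x)))
      = (fact n * exp (real n)) * (\<Prod>x\<in>S. poi (l x) (a x))"
    by (simp add: poi_def prod.distrib prod_dividef)
  also have "\<dots> \<le> (exp 1 * real n * real n ^ n) * (\<Prod>x\<in>S. poi (l x) (a x))"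
    using fact_mult_exp_le[OF n] by (intro mult_right_mono prod_nonneg) (auto intro: poi_nonneg simp: l_def)
  finally have "real n ^ n * measure_pmf.prob (replicate_pmf n p) {xs. \<forall>x\<in>S. count_list xs x = a x}
      \<le> real n ^ n * (exp 1 * real n * (\<Prod>x\<in>S. poi (l x) (a x)))" by (simp only: mult_ac)
  thus ?thesis using n unfolding l_def by (subst (asm) mult_le_cancel_left_pos) auto
next
  case False
  thus ?thesis unfolding prob_counts_replicate_pmf[OF S]
    by (auto intro!: mult_nonneg_nonneg prod_nonneg poi_nonneg)
qed

lemma prob_mono_set_pmf:
  assumes "\<And>x. x \<in> set_pmf p \<Longrightarrow> x \<in> A \<Longrightarrow> x \<in> B"
  shows "measure_pmf.prob p A \<le> measure_pmf.prob p B"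
  using assms by (intro measure_pmf.finite_measure_mono_AE AE_pmfI) auto

text \<open>A union bound over the count vectors on \<open>S\<close>. Since only an inclusion is
  required, \<open>E\<close> may depend on the whole sample.\<close>

lemma prob_counts_event_le_poi:
  fixes p :: "'a pmf"
  assumes S: "finite S" and n: "n \<ge> 1"
    and E: "\<And>xs. xs \<in> E \<Longrightarrow> length xs = n \<Longrightarrow> restrict (count_list xs) S \<in> A"
  shows "measure_pmf.prob (replicate_pmf n p) E
    \<le> exp 1 * real n * (\<Sum>a\<in>A \<inter> PiE S (\<lambda>_. {..n}). \<Prod>x\<in>S. poi (real n * pmf p x) (a x))"
proof -
  let ?B = "A \<inter> PiE S (\<lambda>_. {..n})"
  have fin: "finite ?B" using S by (intro finite_Int disjI2 finite_PiE) auto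
  have "measure_pmf.prob (replicate_pmf n p) E
     \<le> measure_pmf.prob (replicate_pmf n p) (\<Union>a\<in>?B. {xs. \<forall>x\<in>S. count_list xs x = a x})"
  proof (rule prob_mono_set_pmf)
    fix xs assume "xs \<in> set_pmf (replicate_pmf n p)" "xs \<in> E"
    hence "length xs = n" "restrict (count_list xs) S \<in> A" using E by (auto simp: set_replicate_pmf)
    moreover from this have "restrict (count_list xs) S \<in> PiE S (\<lambda>_. {..n})"
      using count_le_length[of xs] by auto
    ultimately show "xs \<in> (\<Union>a\<in>?B. {xs. \<forall>x\<in>S. count_list xs x = a x})"
      by (intro UN_I[of "restrict (count_list xs) S"]) auto
  qed
  also have "\<dots> \<le> (\<Sum>a\<in>?B. measure_pmf.prob (replicate_pmf n p) {xs. \<forall>x\<in>S. count_list xs x = a x})"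
    by (rule measure_pmf.finite_measure_subadditive_finite[OF fin]) auto
  also have "\<dots> \<le> (\<Sum>a\<in>?B. exp 1 * real n * (\<Prod>x\<in>S. poi (real n * pmf p x) (a x)))"
    by (intro sum_mono prob_counts_le_poi S n)
  finally show ?thesis by (simp add: sum_distrib_left)
qed

subsection \<open>The number of distinct values of independent variables\<close>

lemma sum_PiE_insert:
  assumes "x \<notin> S"
  shows "(\<Sum>a\<in>PiE (insert x S) V. f a) = (\<Sum>v\<in>V x. \<Sum>a\<in>PiE S V. f (a(x := v)))"
proof -
  have "(\<Sum>a\<in>PiE (insert x S) V. f a) = (\<Sum>(v, a)\<in>V x \<times> PiE S V. f (a(x := v)))"
    unfolding PiE_insert_eq
    by (subst sum.reindex[OF inj_combinator[OF assms]]) (auto intro!: sum.cong)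
  thus ?thesis by (simp add: sum.cartesian_product)
qed

text \<open>The two sign conditions serve the cases \<open>w >= 1\<close> and \<open>w < 1\<close>
  below. Mixed signs fail: for the two entries 1 and -1 the left-hand side is 1 and the right-hand
  side 0.\<close>

lemma one_plus_sum_le_prod:
  fixes c :: "'b \<Rightarrow> real"
  assumes "(\<forall>x\<in>A. 0 \<le> c x) \<or> (\<forall>x\<in>A. -1 \<le> c x \<and> c x \<le> 0)"
  shows "1 + sum c A \<le> (\<Prod>x\<in>A. 1 + c x)"
  using assms
proof
  assume "\<forall>x\<in>A. 0 \<le> c x"
  thus ?thesis
  proof (induction A rule: infinite_finite_induct)
    case (insert x A)
    have "1 + sum c (insert x A) \<le> (1 + c x) * (1 + sum c A)"
      using insert by (simp add: algebra_simps sum_nonneg)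
    also have "\<dots> \<le> (1 + c x) * (\<Prod>x\<in>A. 1 + c x)" using insert by (intro mult_left_mono) auto
    finally show ?case using insert by simp
  qed auto
next
  assume "\<forall>x\<in>A. -1 \<le> c x \<and> c x \<le> 0"
  thus ?thesis using Weierstrass_prod_ineq[of A "\<lambda>x. - c x"] by (auto simp: sum_negf)
qed

text \<open>The right-hand side is what one would get if the events that the values \<open>v \<in> A\<close> are attained were
  independent. Taking \<open>w > 1\<close> and \<open>w < 1\<close> yields the two tail bounds for the number of distinct
  values. The variables are only sub-normalised on \<open>V\<close>.\<close>
lemma sum_weighted_distinct_values_le:
  fixes q :: "'b \<Rightarrow> 'c \<Rightarrow> real"
  assumes "finite S" "finite V" and q: "\<And>x v. x \<in> S \<Longrightarrow> 0 \<le> q x v"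
    and q1: "\<And>x. x \<in> S \<Longrightarrow> (\<Sum>v\<in>V. q x v) \<le> 1" and w: "w > 0" and "A \<subseteq> V"
  shows "(\<Sum>a\<in>PiE S (\<lambda>_. V). (\<Prod>x\<in>S. q x (a x)) * w ^ card (a ` S \<inter> A))
         \<le> (\<Prod>v\<in>A. 1 + (w - 1) * (1 - (\<Prod>x\<in>S. 1 - q x v)))"
  using assms(1) q q1 \<open>A \<subseteq> V\<close>
proof (induction S arbitrary: A rule: finite_induct)
  case empty
  then show ?case by simp
next
  case (insert x S)
  have finA: "finite A" using insert.prems(3) \<open>finite V\<close> finite_subset by blast
  \<comment> \<open>The probability that no variable in \<open>S\<close> takes the value
    \<open>v\<close>, if the weights are probabilities. Accordingly \<open>h v\<close> is the mean
    of \<open>w\<close> to the indicator that \<open>v\<close> is attained.\<close>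
  define e where "e v = (\<Prod>y\<in>S. 1 - q y v)" for v
  define h where "h v = 1 + (w - 1) * (1 - e v)" for v
  have q_le: "q y v \<le> 1" if "y \<in> insert x S" "v \<in> V" for y v
    using member_le_sum[of v V "q y"] insert.prems(1,2) that \<open>finite V\<close> by fastforce
  have e01: "0 \<le> e v" "e v \<le> 1" if "v \<in> V" for v
    unfolding e_def using q_le insert.prems(1) that by (auto intro!: prod_nonneg prod_le_1)
  have h_pos: "h v > 0" if "v \<in> V" for v
  proof -
    have "h v = e v + w * (1 - e v)" by (simp add: h_def algebra_simps)
    moreover have "e v > 0 \<or> 1 - e v > 0" using e01[OF that] by linarith
    ultimately show ?thesis using e01[OF that] w
      by (metis add_nonneg_pos add_pos_nonneg diff_ge_0_iff_ge less_imp_le mult_nonneg_nonneg mult_pos_pos)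
  qed
  have hA: "0 \<le> prod h A" using insert.prems(3) h_pos by (intro prod_nonneg) (blast intro: less_imp_le)
  define W where "W B = (\<Sum>a\<in>PiE S (\<lambda>_. V). (\<Prod>y\<in>S. q y (a y)) * w ^ card (a ` S \<inter> B))" for B
  have W: "W B \<le> (\<Prod>v\<in>B. h v)" if "B \<subseteq> V" for B
    unfolding W_def h_def e_def using insert.IH[of B] insert.prems that by simp
  \<comment> \<open>Fix the value \<open>v\<close> of the new variable. If \<open>v\<close> lies in
    \<open>A\<close>, it contributes exactly one factor \<open>w\<close>, and the other variables
    count only for \<open>A - {v}\<close>; this is why the induction is over all
    \<open>A\<close>.\<close>
  have step: "(\<Sum>a\<in>PiE S (\<lambda>_. V). (\<Prod>y\<in>insert x S. q y ((a(x := v)) y)) * w ^ card ((a(x := v)) ` insert x S \<inter> A))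
     = q x v * (if v \<in> A then w * W (A - {v}) else W A)" for v
  proof -
    have "(\<Prod>y\<in>insert x S. q y ((a(x := v)) y)) = q x v * (\<Prod>y\<in>S. q y (a y))" for a
      using insert.hyps by (auto intro!: prod.cong)
    moreover have "w ^ card ((a(x := v)) ` insert x S \<inter> A) = 
        (if v \<in> A then w * w ^ card (a ` S \<inter> (A - {v})) else w ^ card (a ` S \<inter> A))" for a
    proof -
      have im: "(a(x := v)) ` insert x S = insert v (a ` S)" using insert.hyps by auto
      have "insert v (a ` S) \<inter> A = (if v \<in> A then insert v (a ` S \<inter> (A - {v})) else a ` S \<inter> A)" by auto
      thus ?thesis unfolding im using finA by auto
    qed
    ultimately show ?thesis unfolding W_def by (simp add: sum_distrib_left mult_ac)
  qed
  \<comment> \<open>The relative change of the factor \<open>h v\<close> when \<open>x\<close> joins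
    \<open>S\<close> (\<open>hc\<close>). It is also the excess of \<open>q x v * w / h v\<close>
    over \<open>q x v\<close> (\<open>qw\<close>), which links the recursion to the new
    product.\<close>
  define c where "c v = q x v * ((w - 1) * e v) / h v" for v
  have hc: "h v * (1 + c v) = 1 + (w - 1) * (1 - (\<Prod>y\<in>insert x S. 1 - q y v))" if "v \<in> V" for v
    using h_pos[OF that] insert.hyps unfolding c_def
    by (simp add: field_simps) (simp add: h_def e_def algebra_simps)
  have qw: "q x v * (w / h v) = q x v + c v" if "v \<in> V" for v
    using h_pos[OF that] unfolding c_def by (simp add: field_simps) (simp add: h_def algebra_simps)
  have "(\<Sum>a\<in>PiE (insert x S) (\<lambda>_. V). (\<Prod>x\<in>insert x S. q x (a x)) * w ^ card (a ` insert x S \<inter> A))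
    = (\<Sum>v\<in>V. q x v * (if v \<in> A then w * W (A - {v}) else W A))"
    by (subst sum_PiE_insert[OF insert.hyps(2)]) (simp only: step)
  also have "\<dots> \<le> (\<Sum>v\<in>V. q x v * (if v \<in> A then w / h v else 1) * (\<Prod>v\<in>A. h v))"
  proof (rule sum_mono)
    fix v assume v: "v \<in> V"
    have "(if v \<in> A then w * W (A - {v}) else W A) \<le> (if v \<in> A then w / h v else 1) * (\<Prod>v\<in>A. h v)"
    proof (cases "v \<in> A")
      case True
      have "(\<Prod>v\<in>A. h v) = h v * (\<Prod>v\<in>A-{v}. h v)" using True finA by (simp add: prod.remove)
      moreover have "W (A - {v}) \<le> (\<Prod>v\<in>A-{v}. h v)" using insert.prems(3) by (intro W) auto
      ultimately show ?thesis using True h_pos[OF v] w by simp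
    next
      case False
      thus ?thesis using W[OF insert.prems(3)] by simp
    qed
    thus "q x v * (if v \<in> A then w * W (A - {v}) else W A)
        \<le> q x v * (if v \<in> A then w / h v else 1) * (\<Prod>v\<in>A. h v)"
      using insert.prems(1)[of x v] by (simp only: mult.assoc) (intro mult_left_mono, auto)
  qed
  also have "\<dots> = (\<Sum>v\<in>V. q x v + (if v \<in> A then c v else 0)) * (\<Prod>v\<in>A. h v)"
    unfolding sum_distrib_right using qw by (intro sum.cong) auto
  also have "(\<Sum>v\<in>V. q x v + (if v \<in> A then c v else 0)) = (\<Sum>v\<in>V. q x v) + (\<Sum>v\<in>A. c v)"
    using insert.prems(3) \<open>finite V\<close> by (simp add: sum.distrib sum.If_cases Int_absorb1 Int_absorb2)
  also have "\<dots> * (\<Prod>v\<in>A. h v) \<le> (1 + (\<Sum>v\<in>A. c v)) * (\<Prod>v\<in>A. h v)"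
    using insert.prems(2)[of x] hA by (intro mult_right_mono) auto
  \<comment> \<open>All \<open>c v\<close> have the sign of \<open>w - 1\<close>, and they are at
    least -1, so the sum is dominated by the product.\<close>
  also have "\<dots> \<le> (\<Prod>v\<in>A. 1 + c v) * (\<Prod>v\<in>A. h v)"
  proof (intro mult_right_mono one_plus_sum_le_prod)
    show "(\<forall>v\<in>A. 0 \<le> c v) \<or> (\<forall>v\<in>A. - 1 \<le> c v \<and> c v \<le> 0)"
    proof (cases "w \<ge> 1")
      case True
      have "0 \<le> c v" if "v \<in> A" for v
        unfolding c_def using that insert.prems e01[of v] h_pos[of v] True by auto
      thus ?thesis by blast
    next
      case False
      have "- 1 \<le> c v \<and> c v \<le> 0" if "v \<in> A" for v
      proof -
        have v: "v \<in> V" using that insert.prems(3) by auto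
        have 0: "q x v * e v \<ge> 0" using insert.prems(1)[of x v] e01[OF v] by auto
        have "q x v * e v * (w - 1) \<le> 0" by (rule mult_nonneg_nonpos[OF 0]) (use False in simp)
        hence "c v \<le> 0"
          unfolding c_def using h_pos[OF v] by (auto intro!: divide_nonpos_pos simp: mult_ac)
        moreover have "q x v * e v \<le> e v"
          using q_le[of x v] e01[OF v] v by (simp add: mult_left_le_one_le insert.prems(1))
        hence "(1 - w) * (q x v * e v) \<le> (1 - w) * e v" using False by (intro mult_left_mono) auto
        hence "- (q x v * ((w - 1) * e v)) \<le> h v" using w by (simp add: h_def algebra_simps)
        hence "- 1 \<le> c v" unfolding c_def using h_pos[OF v] by (simp add: field_simps)
        ultimately show ?thesis by simp
      qed
      thus ?thesis by blast
    qed
    show "0 \<le> prod h A" by (fact hA)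
  qed
  also have "\<dots> = (\<Prod>v\<in>A. 1 + (w - 1) * (1 - (\<Prod>y\<in>insert x S. 1 - q y v)))"
    unfolding prod.distrib[symmetric] using hc insert.prems(3) by (intro prod.cong) (auto simp: mult.commute)
  finally show ?case .
qed

subsection \<open>Flipping lowest bits\<close>

lemma prod_const_sum_Pow:
  fixes c :: real assumes "finite A" shows "(\<Sum>T\<in>Pow A. c ^ card T) = (1 + c) ^ card A"
  using prod_add[OF assms, of "\<lambda>_. c" "\<lambda>_. 1"] by (simp add: add.commute)

definition flip :: "nat \<Rightarrow> nat" where
  "flip v = (if even v then v + 1 else v - 1)"

lemma flip_div2 [simp]: "flip v div 2 = v div 2" and flip_neq [simp]: "flip v \<noteq> v"
  unfolding flip_def by (auto elim!: oddE)

text \<open>The threshold confines attention to values from \<open>2 * k\<close> on. In the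
  application smaller values may also be attained outside \<open>S\<close>, and then the profile
  does not tell how many symbols of \<open>S\<close> attain them.\<close>

definition slots :: "nat \<Rightarrow> ('b \<Rightarrow> nat) \<Rightarrow> 'b set \<Rightarrow> nat set" where
  "slots k a S = {t \<in> (\<lambda>x. a x div 2) ` S. k \<le> t}"

definition slot_rep :: "('b \<Rightarrow> nat) \<Rightarrow> 'b set \<Rightarrow> nat \<Rightarrow> 'b" where
  "slot_rep a S t = (SOME x. x \<in> S \<and> a x div 2 = t)"

lemma slot_rep:
  assumes "t \<in> slots k a S"
  shows "slot_rep a S t \<in> S" "a (slot_rep a S t) div 2 = t"
  using someI_ex[of "\<lambda>x. x \<in> S \<and> a x div 2 = t"] assms by (auto simp: slots_def slot_rep_def)

text \<open>Slots and representatives depend on \<open>a\<close> only through the halves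
  \<open>a x div 2\<close>, which flips preserve. Hence the representatives can be found from the
  flipped counts.\<close>

lemma slot_rep_cong:
  assumes "\<And>x. x \<in> S \<Longrightarrow> a x div 2 = a' x div 2"
  shows "slots k a S = slots k a' S" "slot_rep a S t = slot_rep a' S t"
proof -
  show "slots k a S = slots k a' S" using assms by (auto simp: slots_def image_def)
  have "(\<lambda>x. x \<in> S \<and> a x div 2 = t) = (\<lambda>x. x \<in> S \<and> a' x div 2 = t)" using assms by auto
  thus "slot_rep a S t = slot_rep a' S t" by (simp add: slot_rep_def)
qed

text \<open>The counts \<open>a\<close> outside the slot representatives are unchanged by a flip, so \<open>same\<close> determines the
  counts of the representatives. The flipped counts of different \<open>a \<in> A\<close> are thus distinct, and there
  are at least \<open>2 ^ d\<close> of them for each \<open>a\<close>.\<close>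
lemma sum_same_profile_le:
  fixes q :: "'b \<Rightarrow> nat \<Rightarrow> real" and c :: real
  assumes "finite S" and q: "\<And>x v. x \<in> S \<Longrightarrow> 0 \<le> q x v"
    and q1: "\<And>x. x \<in> S \<Longrightarrow> (\<Sum>v\<le>N + 1. q x v) \<le> 1" and c: "c \<ge> 0"
    and A: "A \<subseteq> PiE S (\<lambda>_. {..N})"
    and ratio: "\<And>a x. a \<in> A \<Longrightarrow> x \<in> S \<Longrightarrow> 2 * k \<le> a x \<Longrightarrow> c * q x (a x) \<le> q x (flip (a x))"
    and same: "\<And>a a' v. a \<in> A \<Longrightarrow> a' \<in> A \<Longrightarrow> 2 * k \<le> v \<Longrightarrow>
                 card {x\<in>S. a x = v} = card {x\<in>S. a' x = v}"
    and d: "\<And>a. a \<in> A \<Longrightarrow> d \<le> card (slots k a S)"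
  shows "(1 + c) ^ d * (\<Sum>a\<in>A. \<Prod>x\<in>S. q x (a x)) \<le> 1"
proof -
  define R where "R a = slot_rep a S ` slots k a S" for a
  define F where "F = (\<lambda>(a, T). \<lambda>x\<in>S. if x \<in> T then flip (a x) else a x)"
  have finA: "finite A" using finite_subset[OF A] \<open>finite S\<close> by (simp add: finite_PiE)
  have finsl: "finite (slots k a S)" for a :: "'b \<Rightarrow> nat" using \<open>finite S\<close> by (auto simp: slots_def)
  have finR: "finite (R a)" for a using finsl by (auto simp: R_def)
  have RS: "R a \<subseteq> S" for a using slot_rep(1)[of _ k a S] by (auto simp: R_def)
  have inj: "inj_on (slot_rep a S) (slots k a S)" for a
    by (rule inj_onI) (metis slot_rep(2))
  have cardR: "card (R a) = card (slots k a S)" for a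
    unfolding R_def using inj by (rule card_image)
  have Fdiv: "F (a, T) x div 2 = a x div 2" if "x \<in> S" for a T x
    using that by (simp add: F_def)
  have injF: "inj_on F (SIGMA a:A. Pow (R a))"
  proof (rule inj_onI, clarify)
    fix a T a' T'
    assume a: "a \<in> A" "a' \<in> A" and T: "T \<subseteq> R a" "T' \<subseteq> R a'" and eq: "F (a, T) = F (a', T')"
    have dv: "a x div 2 = a' x div 2" if "x \<in> S" for x using Fdiv that eq by metis
    have Req: "R a = R a'" and Seq: "slots k a S = slots k a' S" 
      unfolding R_def using slot_rep_cong[of S a a'] dv by auto
    have off: "a x = a' x" if "x \<in> S" "x \<notin> R a" for x
      using fun_cong[OF eq, of x] that T Req by (auto simp: F_def split: if_splits)
    have on: "a x = a' x" if xR: "x \<in> R a" for x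
    \<comment> \<open>Every other symbol in the slot of \<open>x\<close> is a non-representative, so
      its count is already known to agree. A difference at \<open>x\<close> alone would change the
      number of symbols with count \<open>a x\<close> by one, against \<open>same\<close>.\<close>
    proof (rule ccontr)
      assume ne: "a x \<noteq> a' x"
      obtain t where t: "t \<in> slots k a S" "x = slot_rep a S t" using xR by (auto simp: R_def)
      have x: "x \<in> S" "a x div 2 = t" "k \<le> t" using slot_rep[OF t(1)] t by (auto simp: slots_def)
      have others: "a y = a' y" if y: "y \<in> S" "y \<noteq> x" "a y div 2 = t" for y
      proof (rule off[OF y(1)])
        show "y \<notin> R a"
        proof
          assume "y \<in> R a"
          then obtain u where u: "u \<in> slots k a S" "y = slot_rep a S u" by (auto simp: R_def)
          thus False using slot_rep(2)[OF u(1)] y t by auto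
        qed
      qed
      have "{y\<in>S. a y = a x} = insert x {y\<in>S. a' y = a x}"
      proof (intro set_eqI iffI)
        fix y assume "y \<in> {y\<in>S. a y = a x}"
        thus "y \<in> insert x {y\<in>S. a' y = a x}" using others[of y] x by (cases "y = x") auto
      next
        fix y assume y: "y \<in> insert x {y\<in>S. a' y = a x}"
        show "y \<in> {y\<in>S. a y = a x}"
        proof (cases "y = x")
          case False
          hence yy: "y \<in> S" "a' y = a x" using y by auto
          hence "a y div 2 = t" using dv[of y] x by simp
          thus ?thesis using others[of y] yy False by auto
        qed (use x in auto)
      qed
      moreover have "x \<notin> {y\<in>S. a' y = a x}" using ne by auto
      ultimately have "card {y\<in>S. a y = a x} = Suc (card {y\<in>S. a' y = a x})"
        using \<open>finite S\<close> by simp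
      moreover have "2 * k \<le> a x" using x by linarith
      ultimately show False using same[OF a, of "a x"] by simp
    qed
    have aa: "a = a'"
      using a A on off by (intro PiE_ext[of a S "\<lambda>_. {..N}" a']) blast+
    \<comment> \<open>Since \<open>flip\<close> has no fixed point, the flipped set is recovered as
      the set where the counts changed.\<close>
    have "x \<in> T \<longleftrightarrow> x \<in> T'" if "x \<in> S" for x
      using fun_cong[OF eq, of x] that aa flip_neq[of "a' x"] flip_neq[of "a' x", symmetric] by (auto simp: F_def split: if_splits)
    hence "T = T'" using T Req RS by blast
    thus "a = a' \<and> T = T'" using aa by simp
  qed
  \<comment> \<open>Flipping an even \<open>N\<close> gives \<open>N + 1\<close>, hence the larger
    range here and in \<open>q1\<close>.\<close>
  have FP: "F ` (SIGMA a:A. Pow (R a)) \<subseteq> PiE S (\<lambda>_. {..N+1})"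
  proof clarify
    fix a T assume a: "a \<in> A"
    have "a x \<le> N" if "x \<in> S" for x using a A that by blast
    moreover have "flip v \<le> v + 1" for v by (auto simp: flip_def)
    ultimately have "F (a, T) x \<le> N + 1" if "x \<in> S" for x
      unfolding F_def using that by (auto intro: le_SucI) (metis add_le_mono1 Suc_eq_plus1 order_trans)
    thus "F (a, T) \<in> PiE S (\<lambda>_. {..N+1})" by (intro PiE_I) (auto simp: F_def)
  qed
  have FQ: "c ^ card T * (\<Prod>x\<in>S. q x (a x)) \<le> (\<Prod>x\<in>S. q x (F (a, T) x))"
    if a: "a \<in> A" and T: "T \<subseteq> R a" for a T
  proof -
    have TS: "T \<subseteq> S" using T RS by blast
    have "c ^ card T * (\<Prod>x\<in>S. q x (a x)) = (\<Prod>x\<in>S. (if x \<in> T then c else 1) * q x (a x))"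
      using TS \<open>finite S\<close> by (simp add: prod.distrib prod.If_cases Int_absorb1 flip: prod.inter_restrict)
    also have "\<dots> \<le> (\<Prod>x\<in>S. q x (F (a, T) x))"
    proof (intro prod_mono conjI)
      fix x assume x: "x \<in> S"
      show "0 \<le> (if x \<in> T then c else 1) * q x (a x)" using q[OF x] c by simp
      show "(if x \<in> T then c else 1) * q x (a x) \<le> q x (F (a, T) x)"
      proof (cases "x \<in> T")
        case True
        then obtain t where t: "t \<in> slots k a S" "x = slot_rep a S t" using T by (auto simp: R_def)
        have "k \<le> a x div 2" using slot_rep(2)[OF t(1)] t by (auto simp: slots_def)
        hence "2 * k \<le> a x" by linarith
        thus ?thesis using ratio[OF a x] True x by (simp add: F_def)
      qed (use x in \<open>simp add: F_def\<close>)
    qed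
    finally show ?thesis .
  qed
  have "(1 + c) ^ d * (\<Sum>a\<in>A. \<Prod>x\<in>S. q x (a x)) \<le> (\<Sum>a\<in>A. (1 + c) ^ card (R a) * (\<Prod>x\<in>S. q x (a x)))"
    unfolding sum_distrib_left using d c q
    by (intro sum_mono mult_right_mono power_increasing prod_nonneg) (auto simp: cardR)
  \<comment> \<open>Each representative is either flipped, at cost \<open>c\<close>, or kept;
    summing over all choices gives \<open>1 + c\<close> per representative.\<close>
  also have "\<dots> = (\<Sum>a\<in>A. \<Sum>T\<in>Pow (R a). c ^ card T * (\<Prod>x\<in>S. q x (a x)))"
    by (simp add: prod_const_sum_Pow[OF finR, symmetric] sum_distrib_right)
  also have "\<dots> \<le> (\<Sum>a\<in>A. \<Sum>T\<in>Pow (R a). \<Prod>x\<in>S. q x (F (a, T) x))"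
    using FQ by (intro sum_mono) auto
  also have "\<dots> = (\<Sum>z\<in>(SIGMA a:A. Pow (R a)). \<Prod>x\<in>S. q x (F z x))"
    using finA finR by (subst sum.Sigma) auto
  also have "\<dots> = (\<Sum>b\<in>F ` (SIGMA a:A. Pow (R a)). \<Prod>x\<in>S. q x (b x))"
    by (subst sum.reindex[OF injF]) simp
  also have "\<dots> \<le> (\<Sum>b\<in>PiE S (\<lambda>_. {..N+1}). \<Prod>x\<in>S. q x (b x))"
    using FP q \<open>finite S\<close> by (intro sum_mono2 prod_nonneg finite_PiE) auto
  also have "\<dots> = (\<Prod>x\<in>S. \<Sum>v\<le>N+1. q x v)"
    using \<open>finite S\<close> by (subst prod_sum_PiE) auto
  also have "\<dots> \<le> 1" using q q1 by (intro prod_le_1 conjI sum_nonneg)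
  finally show ?thesis .
qed

text \<open>There are at most \<open>2 * k\<close> values below the threshold, and each slot holds
  two values.\<close>

lemma card_values_le_slots:
  assumes "finite S"
  shows "card (a ` S) \<le> 2 * k + 2 * card (slots k a S)"
proof -
  have fin: "finite (slots k a S)" using assms by (auto simp: slots_def)
  have "a ` S \<subseteq> {..<2 * k} \<union> (\<Union>t\<in>slots k a S. {2 * t, 2 * t + 1})"
  proof clarify
    fix x assume x: "x \<in> S" "a x \<notin> (\<Union>t\<in>slots k a S. {2 * t, 2 * t + 1})"
    have "a x \<in> {2 * (a x div 2), 2 * (a x div 2) + 1}" by auto
    hence "\<not> k \<le> a x div 2" using x by (auto simp: slots_def)
    thus "a x < 2 * k" by linarith
  qed
  hence "card (a ` S) \<le> card ({..<2 * k} \<union> (\<Union>t\<in>slots k a S. {2 * t, 2 * t + 1}))"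
    using fin by (intro card_mono) auto
  also have "\<dots> \<le> card {..<2 * k} + card (\<Union>t\<in>slots k a S. {2 * t, 2 * t + 1})" by (rule card_Un_le)
  also have "card (\<Union>t\<in>slots k a S. {2 * t, 2 * t + 1}) \<le> (\<Sum>t\<in>slots k a S. card {2 * t, 2 * t + 1})"
    by (rule card_UN_le[OF fin])
  also have "\<dots> = 2 * card (slots k a S)" by simp
  finally show ?thesis by simp
qed

text \<open>The ratio of the two weights is \<open>l / (v + 1)\<close> for even \<open>v\<close> and
  \<open>v / l\<close> for odd \<open>v\<close>. On the given range these are at least 1/5 and
  1/4.\<close>

lemma poi_flip_ge:
  assumes l: "l \<ge> 4" and v: "l / 4 \<le> real v" "real v \<le> 4 * l"
  shows "1 / 5 * poi l v \<le> poi l (flip v)"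
proof (cases "even v")
  case True
  have "1 / 5 * poi l v \<le> l / real (Suc v) * poi l v"
    using l v by (intro mult_right_mono poi_nonneg) (auto simp: field_simps)
  thus ?thesis using True by (simp add: flip_def poi_Suc)
next
  case False
  then obtain u where u: "v = Suc u" by (cases v) auto
  have "1 / 5 * poi l v = (1 / 5 * (l / real (Suc u))) * poi l u" by (simp add: u poi_Suc)
  also have "\<dots> \<le> 1 * poi l u"
    using l v u by (intro mult_right_mono poi_nonneg) (auto simp: field_simps)
  finally show ?thesis using False u by (simp add: flip_def)
qed

subsection \<open>Concentration of the dimension\<close>

lemma count_profile: "count (profile xs) v = card {x \<in> set xs. count_list xs x = v}"
proof -
  have "count (image_mset f (mset_set A)) v = card {x\<in>A. f x = v}" if "finite A" for f :: "'a \<Rightarrow> nat" and A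
    using that
  proof (induction A rule: finite_induct)
    case (insert x A)
    have "{y \<in> insert x A. f y = v} = (if f x = v then insert x {y\<in>A. f y = v} else {y\<in>A. f y = v})"
      by auto
    thus ?case using insert by simp
  qed auto
  thus ?thesis by (simp add: profile_def)
qed

lemma set_mset_profile: "set_mset (profile xs) = count_list xs ` set xs"
  by (simp add: profile_def)

lemma mset_dimension_profile: "mset_dimension (profile xs) = card (count_list xs ` set xs)"
  by (simp add: mset_dimension_def set_mset_profile)

lemma mset_dimension_profile_le: "mset_dimension (profile xs) \<le> length xs"
  unfolding mset_dimension_profile using card_image_le[of "set xs"] card_length[of xs] le_trans by blast

lemma mset_dimension_profile_pos: "xs \<noteq> [] \<Longrightarrow> mset_dimension (profile xs) \<ge> 1"
  unfolding mset_dimension_profile by (simp add: Suc_le_eq card_gt_0_iff)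

section \<open>Heavy symbols and the exponential moments of their distinct counts\<close>

locale iid_sample =
  fixes p :: "nat pmf" and n :: nat
  assumes n_ge_1: "n \<ge> 1"
begin

text \<open>\<open>exp L\<close> is the factor \<open>e * n\<close> lost in the Poisson comparison,
  so each use of that comparison costs one \<open>L\<close> in the exponent.\<close>

definition L :: real where "L = 1 + ln (real n)"

definition lam :: "nat \<Rightarrow> real" where "lam x = real n * pmf p x"

definition heavy :: "nat set" where "heavy = {x. 16 * L \<le> lam x}"

text \<open>Counts outside \<open>heavy\<close> will stay below \<open>2 * cutoff\<close>. With
  \<open>lam x < 16 * L\<close> and a count \<open>Suc u\<close> of at least \<open>38 * L\<close>,
  the exponent \<open>2 * lam x - u\<close> is at most \<open>- 5 * L\<close>.\<close>

definition cutoff :: nat where "cutoff = nat \<lceil>19 * L\<rceil>"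

text \<open>The expected number of distinct values up to \<open>n\<close> among independent Poisson
  counts of the heavy symbols.\<close>

definition mu :: real where "mu = (\<Sum>v\<le>n. 1 - (\<Prod>x\<in>heavy. 1 - poi (lam x) v))"

abbreviation "P \<equiv> replicate_pmf n p"

lemma L_ge_1: "L \<ge> 1" using n_ge_1 by (simp add: L_def)

lemma exp_L: "exp L = exp 1 * real n" using n_ge_1 by (simp add: L_def exp_add)

lemma n_le: "real n \<le> exp L" and Suc_n_le: "real n + 1 \<le> exp L"
proof -
  have "2 * real n \<le> exp 1 * real n" using exp_ge_add_one_self[of 1] by (intro mult_right_mono) auto
  moreover have "real n \<ge> 1" using n_ge_1 by simp
  ultimately show "real n \<le> exp L" "real n + 1 \<le> exp L" unfolding exp_L by linarith+
qed

lemma exp_minus_L_le: "exp (- L) \<le> 1 / real n"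
  using n_le n_ge_1 by (simp add: exp_minus divide_inverse)

lemma lam_nonneg [simp]: "lam x \<ge> 0" by (simp add: lam_def)

lemma cutoff_bounds: "19 * L \<le> real cutoff" "real cutoff \<le> 20 * L"
  using L_ge_1 unfolding cutoff_def by linarith+

lemma length_P: "xs \<in> set_pmf P \<Longrightarrow> length xs = n" by (auto simp: set_replicate_pmf)

text \<open>The means \<open>lam x\<close> sum to at most \<open>n\<close>, and each heavy one is at
  least 1.\<close>

lemma finite_heavy: "finite heavy" and card_heavy_le: "card heavy \<le> n"
proof -
  have "card F \<le> n" if F: "finite F" "F \<subseteq> heavy" for F
  proof -
    have "(\<Sum>x\<in>F. 1) \<le> (\<Sum>x\<in>F. lam x)"
      using F L_ge_1 by (intro sum_mono) (force simp: heavy_def)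
    also have "\<dots> = real n * measure_pmf.prob p F"
      using F by (simp add: lam_def measure_measure_pmf_finite sum_distrib_left)
    also have "\<dots> \<le> real n * 1" by (intro mult_left_mono) auto
    finally show ?thesis by simp
  qed
  thus "finite heavy" "card heavy \<le> n" using finite_if_finite_subsets_card_bdd[of heavy n] by auto
qed

text \<open>The product bound for distinct values with \<open>w = exp s\<close>, followed by
  \<open>1 + z <= exp z\<close> in each factor.\<close>

lemma sum_exp_distinct_le:
  "(\<Sum>a\<in>PiE heavy (\<lambda>_. {..n}). (\<Prod>x\<in>heavy. poi (lam x) (a x)) * exp (s * real (card (a ` heavy)))) 
    \<le> exp ((exp s - 1) * mu)"
proof -
  let ?q = "\<lambda>x v. poi (lam x) v"
  let ?g = "\<lambda>v. 1 - (\<Prod>x\<in>heavy. 1 - ?q x v)"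
  have q: "0 \<le> ?q x v" "?q x v \<le> 1" for x v
    using poi_nonneg[of "lam x" v] sum_poi_le_1[of "lam x" "{v}"] by auto
  have g: "0 \<le> ?g v" "?g v \<le> 1" for v
    using prod_le_1[of heavy "\<lambda>x. 1 - ?q x v"] prod_nonneg[of heavy "\<lambda>x. 1 - ?q x v"] q by auto
  have "(\<Sum>a\<in>PiE heavy (\<lambda>_. {..n}). (\<Prod>x\<in>heavy. ?q x (a x)) * exp (s * real (card (a ` heavy))))
     = (\<Sum>a\<in>PiE heavy (\<lambda>_. {..n}). (\<Prod>x\<in>heavy. ?q x (a x)) * exp s ^ card (a ` heavy \<inter> {..n}))"
  proof (intro sum.cong refl)
    fix a assume "a \<in> PiE heavy (\<lambda>_. {..n})"
    hence "a ` heavy \<inter> {..n} = a ` heavy" by auto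
    thus "(\<Prod>x\<in>heavy. ?q x (a x)) * exp (s * real (card (a ` heavy))) = 
      (\<Prod>x\<in>heavy. ?q x (a x)) * exp s ^ card (a ` heavy \<inter> {..n})"
      by (simp add: exp_of_nat_mult[symmetric] mult.commute)
  qed
  also have "\<dots> \<le> (\<Prod>v\<le>n. 1 + (exp s - 1) * ?g v)"
    using finite_heavy q sum_poi_le_1 by (intro sum_weighted_distinct_values_le) auto
  also have "\<dots> \<le> (\<Prod>v\<le>n. exp ((exp s - 1) * ?g v))"
  proof (intro prod_mono conjI exp_ge_add_one_self)
    fix v
    \<comment> \<open>Nonnegativity has to be checked because \<open>s\<close> may be negative: the
      factor is a convex combination of 1 and \<open>exp s\<close>.\<close>
    have "1 + (exp s - 1) * ?g v = (1 - ?g v) + exp s * ?g v" by (simp add: algebra_simps)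
    also have "\<dots> \<ge> 0" using g[of v] by (intro add_nonneg_nonneg mult_nonneg_nonneg) auto
    finally show "0 \<le> 1 + (exp s - 1) * ?g v" .
  qed
  also have "\<dots> = exp ((exp s - 1) * mu)"
    by (simp add: exp_sum mu_def sum_distrib_left)
  finally show ?thesis .
qed

definition large_values :: "nat list \<Rightarrow> real" where "large_values xs = real (card (count_list xs ` heavy))"

text \<open>Markov's inequality for the exponential moment, after the Poisson comparison, which
  contributes the summand \<open>L\<close>. A negative \<open>s\<close> yields the lower
  tail.\<close>

lemma prob_large_values_exp_le:
  "measure_pmf.prob P {xs. s * large_values xs \<ge> r} \<le> exp (L + (exp s - 1) * mu - r)"
proof -
  let ?A = "{a. s * real (card (a ` heavy)) \<ge> r}"
  have fin: "finite (PiE heavy (\<lambda>_. {..n}))" using finite_heavy by (simp add: finite_PiE)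
  have Q: "0 \<le> (\<Prod>x\<in>heavy. poi (lam x) (a x))" for a by (intro prod_nonneg) (auto intro: poi_nonneg)
  have "measure_pmf.prob P {xs. s * large_values xs \<ge> r}
    \<le> exp 1 * real n * (\<Sum>a\<in>?A \<inter> PiE heavy (\<lambda>_. {..n}). \<Prod>x\<in>heavy. poi (real n * pmf p x) (a x))"
    by (rule prob_counts_event_le_poi[OF finite_heavy n_ge_1]) (simp add: large_values_def)
  also have "\<dots> = exp L * (\<Sum>a\<in>?A \<inter> PiE heavy (\<lambda>_. {..n}). \<Prod>x\<in>heavy. poi (lam x) (a x))"
    by (simp add: exp_L lam_def)
  also have "(\<Sum>a\<in>?A \<inter> PiE heavy (\<lambda>_. {..n}). \<Prod>x\<in>heavy. poi (lam x) (a x)) \<le>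
     (\<Sum>a\<in>?A \<inter> PiE heavy (\<lambda>_. {..n}). (\<Prod>x\<in>heavy. poi (lam x) (a x)) * exp (s * real (card (a ` heavy)) - r))"
  proof (intro sum_mono)
    fix a assume "a \<in> ?A \<inter> PiE heavy (\<lambda>_. {..n})"
    hence "1 \<le> exp (s * real (card (a ` heavy)) - r)" by simp
    from mult_left_mono[OF this Q[of a]]
    show "(\<Prod>x\<in>heavy. poi (lam x) (a x)) \<le> (\<Prod>x\<in>heavy. poi (lam x) (a x)) * exp (s * real (card (a ` heavy)) - r)"
      by simp
  qed
  also have "\<dots> \<le> (\<Sum>a\<in>PiE heavy (\<lambda>_. {..n}). (\<Prod>x\<in>heavy. poi (lam x) (a x)) * exp (s * real (card (a ` heavy)) - r))"
    using fin Q by (intro sum_mono2) auto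
  also have "\<dots> = (\<Sum>a\<in>PiE heavy (\<lambda>_. {..n}). (\<Prod>x\<in>heavy. poi (lam x) (a x)) * exp (s * real (card (a ` heavy)))) * exp (- r)"
    by (simp add: sum_distrib_right mult.assoc mult_exp_exp)
  also have "\<dots> \<le> exp ((exp s - 1) * mu) * exp (- r)"
    by (intro mult_right_mono sum_exp_distinct_le) auto
  finally show ?thesis by (simp add: mult_exp_exp algebra_simps)
qed

lemma mu_nonneg: "mu \<ge> 0"
  unfolding mu_def
proof (intro sum_nonneg)
  fix v
  have "(\<Prod>x\<in>heavy. 1 - poi (lam x) v) \<le> 1"
    using poi_nonneg[of _ v] sum_poi_le_1[of _ "{v}"] by (intro prod_le_1) auto
  thus "0 \<le> 1 - (\<Prod>x\<in>heavy. 1 - poi (lam x) v)" by simp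
qed

lemma prob_large_values_upper: "measure_pmf.prob P {xs. large_values xs \<ge> 2 * mu + 2 * L} \<le> 1 / real n"
proof -
  \<comment> \<open>With \<open>s = 1\<close> the exponent is at most
    \<open>L + 2 * mu - (2 * mu + 2 * L) = - L\<close>.\<close>
  have "measure_pmf.prob P {xs. 1 * large_values xs \<ge> 2 * mu + 2 * L} \<le> exp (L + (exp 1 - 1) * mu - (2 * mu + 2 * L))"
    by (rule prob_large_values_exp_le)
  also have "(exp 1 - 1) * mu \<le> 2 * mu" using exp_le mu_nonneg by (intro mult_right_mono) auto
  hence "exp (L + (exp 1 - 1) * mu - (2 * mu + 2 * L)) \<le> exp (- L)" by simp
  also note exp_minus_L_le
  finally show ?thesis by simp
qed

lemma prob_large_values_lower: "measure_pmf.prob P {xs. large_values xs \<le> mu / 2 - 2 * L} \<le> 1 / real n"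
proof -
  have "measure_pmf.prob P {xs. (-1) * large_values xs \<ge> 2 * L - mu / 2} \<le> exp (L + (exp (-1) - 1) * mu - (2 * L - mu / 2))"
    by (rule prob_large_values_exp_le)
  also have "exp (-1) \<le> (1/2 :: real)"
    using exp_ge_add_one_self[of 1] by (simp add: exp_minus field_simps)
  hence "(exp (-1) - 1) * mu \<le> (- 1 / 2) * mu" using mu_nonneg by (intro mult_right_mono) auto
  hence "exp (L + (exp (-1) - 1) * mu - (2 * L - mu / 2)) \<le> exp (- L)" by simp
  also note exp_minus_L_le
  also have "{xs. (-1) * large_values xs \<ge> 2 * L - mu / 2} = {xs. large_values xs \<le> mu / 2 - 2 * L}" by auto
  finally show ?thesis .
qed

text \<open>One factor \<open>exp L\<close> comes from the Poisson comparison, the other from the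
  union over at most \<open>n + 1\<close> values.\<close>

lemma prob_count_in_le:
  assumes "\<And>v. v \<in> B \<Longrightarrow> poi (lam x) v \<le> b" and "b \<ge> 0"
  shows "measure_pmf.prob P {xs. count_list xs x \<in> B} \<le> exp (2 * L) * b"
proof -
  let ?B = "B \<inter> {..n}"
  have "measure_pmf.prob P {xs. count_list xs x \<in> B} 
    \<le> measure_pmf.prob P (\<Union>v\<in>?B. {xs. \<forall>y\<in>{x}. count_list xs y = v})"
    by (rule prob_mono_set_pmf) (use length_P count_le_length in fastforce)
  also have "\<dots> \<le> (\<Sum>v\<in>?B. measure_pmf.prob P {xs. \<forall>y\<in>{x}. count_list xs y = v})"
    by (rule measure_pmf.finite_measure_subadditive_finite) auto
  also have "\<dots> \<le> (\<Sum>v\<in>?B. exp L * b)"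
  proof (intro sum_mono)
    fix v assume "v \<in> ?B"
    hence "exp L * poi (lam x) v \<le> exp L * b" using assms by (intro mult_left_mono) auto
    moreover have "measure_pmf.prob P {xs. \<forall>y\<in>{x}. count_list xs y = v} \<le> exp L * poi (lam x) v"
      using prob_counts_le_poi[OF _ n_ge_1, of "{x}" p "\<lambda>_. v"] by (simp add: exp_L lam_def)
    ultimately show "measure_pmf.prob P {xs. \<forall>y\<in>{x}. count_list xs y = v} \<le> exp L * b"
      by (rule order_trans[rotated])
  qed
  also have "\<dots> = real (card ?B) * (exp L * b)" by simp
  also have "\<dots> \<le> exp L * (exp L * b)"
  proof (rule mult_right_mono)
    have "card ?B \<le> card {..n}" by (intro card_mono) auto
    thus "real (card ?B) \<le> exp L" using Suc_n_le by simp
  qed (use assms in auto)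
  also have "\<dots> = exp (2 * L) * b" by (simp add: mult_exp_exp flip: mult.assoc)
  finally show ?thesis .
qed

section \<open>Typical samples and their probability\<close>

definition good_large :: "nat list \<Rightarrow> bool" where
  "good_large xs \<longleftrightarrow> (\<forall>x\<in>heavy. lam x / 4 \<le> real (count_list xs x) \<and> real (count_list xs x) \<le> 4 * lam x)"

definition good_small :: "nat list \<Rightarrow> bool" where
  "good_small xs \<longleftrightarrow> (\<forall>x. x \<notin> heavy \<longrightarrow> count_list xs x < 2 * cutoff)"

lemma prob_not_good_large: "measure_pmf.prob P {xs. \<not> good_large xs} \<le> 1 / real n"
proof -
  let ?B = "\<lambda>x. {v. \<not> (lam x / 4 \<le> real v \<and> real v \<le> 4 * lam x)}"
  have "measure_pmf.prob P {xs. \<not> good_large xs} = measure_pmf.prob P (\<Union>x\<in>heavy. {xs. count_list xs x \<in> ?B x})"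
    by (rule arg_cong[where f="measure_pmf.prob P"]) (auto simp: good_large_def)
  also have "\<dots> \<le> (\<Sum>x\<in>heavy. measure_pmf.prob P {xs. count_list xs x \<in> ?B x})"
    using finite_heavy by (rule measure_pmf.finite_measure_subadditive_finite) auto
  also have "\<dots> \<le> (\<Sum>x\<in>heavy. exp (2 * L) * exp (- 4 * L))"
  proof (intro sum_mono prob_count_in_le)
    fix x v assume x: "x \<in> heavy" and v: "v \<in> ?B x"
    have l: "lam x \<ge> 16 * L" using x by (simp add: heavy_def)
    from v consider "real v < lam x / 4" | "real v > 4 * lam x" by force
    thus "poi (lam x) v \<le> exp (- 4 * L)"
    proof cases
      \<comment> \<open>Here \<open>v - lam x / 2\<close> is below \<open>- lam x / 4\<close>, hence
        at most \<open>- 4 * L\<close> by the constant 16 in \<open>heavy\<close>. This leaves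
        \<open>exp (- L)\<close> after the factor \<open>exp (2 * L)\<close> and the union over at
        most \<open>n\<close> heavy symbols.\<close>
      case 1
      thus ?thesis using l by (intro order_trans[OF poi_lower_tail]) auto
    next
      case 2
      thus ?thesis using l L_ge_1 by (intro order_trans[OF poi_upper_tail]) auto
    qed
  qed auto
  also have "\<dots> = real (card heavy) * exp (- 2 * L)" by (simp add: mult_exp_exp)
  also have "\<dots> \<le> exp L * exp (- 2 * L)" using card_heavy_le n_le by (intro mult_right_mono) auto
  also have "\<dots> = exp (- L)" by (simp add: mult_exp_exp)
  also note exp_minus_L_le
  finally show ?thesis .
qed

text \<open>Infinitely many symbols may be light, so a uniform tail bound does not suffice. The
  bound for each symbol retains a factor \<open>pmf p x\<close>, which makes the union bound
  summable.\<close>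

lemma prob_not_good_small: "measure_pmf.prob P {xs. \<not> good_small xs} \<le> 1 / real n"
proof -
  define f where "f x = (if x \<in> heavy then {} else {xs. count_list xs x \<in> {2 * cutoff..}})" for x
  have f: "measure_pmf.prob P (f x) \<le> exp (- 2 * L) * pmf p x" for x
  proof (cases "x \<in> heavy")
    case False
    have l: "lam x < 16 * L" using False by (simp add: heavy_def)
    have "measure_pmf.prob P {xs. count_list xs x \<in> {2 * cutoff..}} \<le> exp (2 * L) * (lam x * exp (- 5 * L))"
    proof (rule prob_count_in_le)
      fix v assume v: "v \<in> {2 * cutoff..}"
      hence v38: "real v \<ge> 38 * L" using cutoff_bounds by auto
      then obtain u where u: "v = Suc u" using L_ge_1 by (cases v) auto
      \<comment> \<open>Splitting off one factor of the Poisson weight before applying the tail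
        bound produces the \<open>lam x\<close>, and thus the \<open>pmf p x\<close>.\<close>
      have "poi (lam x) v = lam x / real (Suc u) * poi (lam x) u" unfolding u by (rule poi_Suc)
      also have "\<dots> \<le> lam x / 1 * exp (2 * lam x - real u)"
        by (intro mult_mono divide_left_mono poi_upper_tail) (auto intro: poi_nonneg)
      also have "\<dots> \<le> lam x * exp (- 5 * L)"
        using l v38 u L_ge_1 by (auto intro!: mult_left_mono)
      finally show "poi (lam x) v \<le> lam x * exp (- 5 * L)" .
    qed auto
    also have "\<dots> = real n * (exp (- 3 * L) * pmf p x)"
      by (simp add: lam_def mult_exp_exp mult_ac flip: mult.assoc)
    also have "\<dots> \<le> exp L * (exp (- 3 * L) * pmf p x)" using n_le by (intro mult_right_mono) auto
    also have "\<dots> = exp (- 2 * L) * pmf p x" by (simp add: mult_exp_exp flip: mult.assoc)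
    finally show ?thesis using False by (simp add: f_def)
  qed (simp add: f_def)
  have part: "(\<Sum>x<m. measure_pmf.prob P (f x)) \<le> exp (- 2 * L)" for m
  proof -
    have "(\<Sum>x<m. measure_pmf.prob P (f x)) \<le> (\<Sum>x<m. exp (- 2 * L) * pmf p x)" by (intro sum_mono f)
    also have "\<dots> = exp (- 2 * L) * measure_pmf.prob p {..<m}"
      by (simp add: measure_measure_pmf_finite sum_distrib_left)
    also have "\<dots> \<le> exp (- 2 * L) * 1" by (intro mult_left_mono) auto
    finally show ?thesis by simp
  qed
  have summ: "summable (\<lambda>x. measure_pmf.prob P (f x))"
    by (rule summableI_nonneg_bounded[OF _ part]) auto
  have "measure_pmf.prob P {xs. \<not> good_small xs} = measure_pmf.prob P (\<Union>x. f x)"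
    by (rule arg_cong[where f="measure_pmf.prob P"]) (auto simp: good_small_def f_def not_less split: if_splits)
  also have "\<dots> \<le> (\<Sum>x. measure_pmf.prob P (f x))"
    using summ by (intro measure_pmf.finite_measure_subadditive_countably) auto
  also have "\<dots> \<le> exp (- 2 * L)" using summ part by (rule suminf_le_const)
  also have "\<dots> \<le> exp (- L)" using L_ge_1 by simp
  also note exp_minus_L_le
  finally show ?thesis .
qed

definition good :: "nat list \<Rightarrow> bool" where
  "good xs \<longleftrightarrow> good_large xs \<and> good_small xs \<and> large_values xs \<le> 2 * mu + 2 * L \<and> mu / 2 - 2 * L \<le> large_values xs"

lemma prob_not_good: "measure_pmf.prob P {xs. \<not> good xs} \<le> 4 / real n"
proof -
  let ?A = "{xs. \<not> good_large xs}" and ?B = "{xs. \<not> good_small xs}"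
    and ?C = "{xs. large_values xs \<ge> 2 * mu + 2 * L}" and ?D = "{xs. large_values xs \<le> mu / 2 - 2 * L}"
  have "measure_pmf.prob P {xs. \<not> good xs} \<le> measure_pmf.prob P ((?A \<union> ?B) \<union> (?C \<union> ?D))"
    by (intro measure_pmf.finite_measure_mono) (auto simp: good_def)
  also have "\<dots> \<le> (measure_pmf.prob P ?A + measure_pmf.prob P ?B) + (measure_pmf.prob P ?C + measure_pmf.prob P ?D)"
    by (intro order_trans[OF measure_Un_le] add_mono) auto
  also have "\<dots> \<le> (1 / real n + 1 / real n) + (1 / real n + 1 / real n)"
    by (intro add_mono prob_not_good_large prob_not_good_small prob_large_values_upper prob_large_values_lower)
  finally show ?thesis by simp
qed

text \<open>In a good sample only heavy symbols reach the count \<open>2 * cutoff\<close>, and all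
  heavy symbols occur. So the dimension lies between \<open>large_values\<close> and
  \<open>large_values + 2 * cutoff\<close>, where \<open>2 * cutoff <= 40 * L\<close>. In
  \<open>mu_le\<close> the additive \<open>4 * L\<close> is absorbed because the dimension is at
  least 1.\<close>

lemma
  assumes "length xs = n" "good xs"
  shows count_large_eq: "v \<ge> 2 * cutoff \<Longrightarrow> card {x\<in>heavy. count_list xs x = v} = count (profile xs) v"
    and dimension_le: "real (mset_dimension (profile xs)) \<le> 2 * mu + 42 * L"
    and mu_le: "mu \<le> 6 * L * real (mset_dimension (profile xs))"
proof -
  have small: "count_list xs x < 2 * cutoff" if "x \<notin> heavy" for x
    using assms(2) that by (auto simp: good_def good_small_def)
  have cutoff_pos: "cutoff > 0" using cutoff_bounds L_ge_1 by (intro Nat.gr0I) auto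
  have "x \<in> heavy \<and> x \<in> set xs" if "count_list xs x \<ge> 2 * cutoff" for x
    using that small[of x] cutoff_pos count_notin[of x xs] by linarith
  hence "{x\<in>heavy. count_list xs x = v} = {x\<in>set xs. count_list xs x = v}" if "v \<ge> 2 * cutoff" for v
    using that by auto
  thus "v \<ge> 2 * cutoff \<Longrightarrow> card {x\<in>heavy. count_list xs x = v} = count (profile xs) v"
    by (simp add: count_profile)
  have "heavy \<subseteq> set xs"
  proof
    fix x assume x: "x \<in> heavy"
    have "lam x / 4 \<le> real (count_list xs x)" using assms(2) x by (auto simp: good_def good_large_def)
    moreover have "lam x > 0" using x L_ge_1 by (auto simp: heavy_def)
    ultimately have "count_list xs x \<noteq> 0" by auto
    thus "x \<in> set xs" by (simp add: count_list_0_iff)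
  qed
  hence "card (count_list xs ` heavy) \<le> card (count_list xs ` set xs)" by (intro card_mono image_mono) auto
  hence D: "large_values xs \<le> real (mset_dimension (profile xs))" by (simp add: large_values_def mset_dimension_profile)
  have "card (count_list xs ` set xs) \<le> card (count_list xs ` heavy \<union> {..<2 * cutoff})"
    using finite_heavy small by (intro card_mono) auto
  also have "\<dots> \<le> card (count_list xs ` heavy) + 2 * cutoff" using card_Un_le[of "count_list xs ` heavy" "{..<2*cutoff}"] by simp
  finally have "real (mset_dimension (profile xs)) \<le> large_values xs + 2 * real cutoff"
    by (simp add: large_values_def mset_dimension_profile)
  thus "real (mset_dimension (profile xs)) \<le> 2 * mu + 42 * L"
    using assms(2) cutoff_bounds unfolding good_def by linarith
  have "xs \<noteq> []" using assms(1) n_ge_1 by auto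
  hence D1: "real (mset_dimension (profile xs)) \<ge> 1" using mset_dimension_profile_pos by force
  have "mu \<le> 2 * real (mset_dimension (profile xs)) + 4 * L"
    using D assms(2) unfolding good_def by linarith
  moreover have "2 * real (mset_dimension (profile xs)) \<le> 2 * L * real (mset_dimension (profile xs))"
    using L_ge_1 by (intro mult_right_mono) auto
  moreover have "4 * L * 1 \<le> 4 * L * real (mset_dimension (profile xs))"
    using L_ge_1 D1 by (intro mult_left_mono) auto
  ultimately show "mu \<le> 6 * L * real (mset_dimension (profile xs))" by linarith
qed

section \<open>The probability of one profile within the good samples\<close>

lemma prob_profile_good_le:
  "measure_pmf.prob P {xs. profile xs = \<phi> \<and> good xs} \<le> exp (5 * L - mu / 24)"
proof -
  define A where "A = {restrict (count_list xs) heavy | xs. length xs = n \<and> profile xs = \<phi> \<and> good xs}"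
  \<comment> \<open>At least \<open>mu / 2 - 2 * L\<close> distinct values, minus at most
    \<open>40 * L\<close> below the threshold, two per slot.\<close>
  define d where "d = nat \<lceil>mu / 4 - 21 * L\<rceil>"
  have AP: "A \<subseteq> PiE heavy (\<lambda>_. {..n})"
    unfolding A_def using count_le_length by fastforce
  have "(1 + 1/5) ^ d * (\<Sum>a\<in>A. \<Prod>x\<in>heavy. poi (lam x) (a x)) \<le> 1"
  proof (rule sum_same_profile_le[OF finite_heavy _ _ _ AP, where k = cutoff])
    show "0 \<le> poi (lam x) v" for x v by (simp add: poi_nonneg)
    show "(\<Sum>v\<le>n + 1. poi (lam x) v) \<le> 1" for x by (rule sum_poi_le_1) auto
  next
    fix a x assume a: "a \<in> A" and x: "x \<in> heavy"
    have "lam x \<ge> 4" using x L_ge_1 by (simp add: heavy_def)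
    thus "1 / 5 * poi (lam x) (a x) \<le> poi (lam x) (flip (a x))"
      using a x by (intro poi_flip_ge) (auto simp: A_def good_def good_large_def)
  next
    \<comment> \<open>From \<open>2 * cutoff\<close> on, the profile determines how many heavy
      symbols have count \<open>v\<close>, by \<open>count_large_eq\<close>.\<close>
    fix a a' v assume a: "a \<in> A" "a' \<in> A" and v: "2 * cutoff \<le> v"
    have "card {x\<in>heavy. a x = v} = count \<phi> v" if a: "a \<in> A" for a
    proof -
      obtain xs where xs: "a = restrict (count_list xs) heavy" "length xs = n" "profile xs = \<phi>" "good xs"
        using a by (auto simp: A_def)
      have "{x\<in>heavy. a x = v} = {x\<in>heavy. count_list xs x = v}" using xs(1) by auto
      thus ?thesis using count_large_eq[OF xs(2,4) v] xs(3) by simp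
    qed
    thus "card {x\<in>heavy. a x = v} = card {x\<in>heavy. a' x = v}" using a by simp
  next
    fix a assume "a \<in> A"
    then obtain xs where xs: "a = restrict (count_list xs) heavy" "good xs" by (auto simp: A_def)
    have "a ` heavy = count_list xs ` heavy" using xs(1) by auto
    hence "large_values xs = real (card (a ` heavy))" by (simp add: large_values_def)
    also have "\<dots> \<le> 2 * real cutoff + 2 * real (card (slots cutoff a heavy))"
      using card_values_le_slots[OF finite_heavy, of a cutoff] by linarith
    finally have "mu / 4 - 21 * L \<le> real (card (slots cutoff a heavy))"
      using xs(2) cutoff_bounds unfolding good_def by linarith
    thus "d \<le> card (slots cutoff a heavy)" unfolding d_def by linarith
  qed auto
  moreover have "exp (mu / 24 - 21 / 6 * L) \<le> (1 + 1/5) ^ d"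
  proof -
    \<comment> \<open>\<open>5 / 6 <= exp (- 1 / 6)\<close> shows that each slot gains at least
      \<open>exp (1 / 6)\<close>.\<close>
    have "1 + (- 1 / 6) \<le> exp (- 1 / 6 :: real)" by (rule exp_ge_add_one_self)
    hence e: "exp (1 / 6) \<le> (1 + 1 / 5 :: real)" by (simp add: exp_minus field_simps)
    have "mu / 4 - 21 * L \<le> real d" unfolding d_def by (rule real_nat_ceiling_ge)
    hence "exp (mu / 24 - 21 / 6 * L) \<le> exp (real d * (1 / 6))" by simp
    also have "\<dots> = exp (1 / 6) ^ d" by (rule exp_of_nat_mult)
    also have "\<dots> \<le> (1 + 1 / 5) ^ d" using e by (intro power_mono) auto
    finally show ?thesis .
  qed
  moreover have Q: "0 \<le> (\<Sum>a\<in>A. \<Prod>x\<in>heavy. poi (lam x) (a x))"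
    by (intro sum_nonneg prod_nonneg) (auto intro: poi_nonneg)
  ultimately have "exp (mu / 24 - 21 / 6 * L) * (\<Sum>a\<in>A. \<Prod>x\<in>heavy. poi (lam x) (a x)) \<le> 1"
    by (meson mult_right_mono order_trans)
  hence "exp (21 / 6 * L - mu / 24) * (exp (mu / 24 - 21 / 6 * L) * (\<Sum>a\<in>A. \<Prod>x\<in>heavy. poi (lam x) (a x)))
      \<le> exp (21 / 6 * L - mu / 24) * 1" by (intro mult_left_mono) auto
  hence "(\<Sum>a\<in>A. \<Prod>x\<in>heavy. poi (lam x) (a x)) \<le> exp (21 / 6 * L - mu / 24)"
    by (simp add: mult_exp_exp flip: mult.assoc)
  hence "exp L * (\<Sum>a\<in>A. \<Prod>x\<in>heavy. poi (lam x) (a x)) \<le> exp L * exp (21 / 6 * L - mu / 24)"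
    by (intro mult_left_mono) auto
  also have "\<dots> \<le> exp (5 * L - mu / 24)" using L_ge_1 by (simp add: mult_exp_exp)
  finally have "exp L * (\<Sum>a\<in>A. \<Prod>x\<in>heavy. poi (lam x) (a x)) \<le> exp (5 * L - mu / 24)" .
  moreover have "measure_pmf.prob P {xs. profile xs = \<phi> \<and> good xs} \<le>
    exp 1 * real n * (\<Sum>a\<in>A \<inter> PiE heavy (\<lambda>_. {..n}). \<Prod>x\<in>heavy. poi (real n * pmf p x) (a x))"
    by (rule prob_counts_event_le_poi[OF finite_heavy n_ge_1]) (auto simp: A_def)
  moreover have "A \<inter> PiE heavy (\<lambda>_. {..n}) = A" using AP by auto
  ultimately show ?thesis by (simp add: exp_L lam_def)
qed

subsection \<open>Entropy and dimension\<close>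

definition profile_pmf :: "nat multiset pmf" where "profile_pmf = map_pmf profile P"

definition ent :: real where "ent = (\<Sum>\<phi>\<in>set_pmf profile_pmf. pmf profile_pmf \<phi> * - ln (pmf profile_pmf \<phi>))"

lemma set_profile_pmf: "\<phi> \<in> set_pmf profile_pmf \<Longrightarrow> \<exists>xs :: nat list. length xs = n \<and> \<phi> = profile xs"
  unfolding profile_pmf_def set_map_pmf using length_P by blast

text \<open>Encodes a profile as a subset of an \<open>n\<close> by \<open>n\<close> grid whose size
  is the dimension, so that sums over profiles are bounded by sums over subsets.\<close>

definition graph :: "nat multiset \<Rightarrow> (nat \<times> nat) set" where
  "graph \<phi> = (\<lambda>i. (i, count \<phi> i)) ` set_mset \<phi>"

lemma inj_graph: "inj graph"
proof (rule injI)
  fix \<phi> \<psi> assume eq: "graph \<phi> = graph \<psi>"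
  have mem: "(i, j) \<in> graph \<phi> \<longleftrightarrow> j > 0 \<and> count \<phi> i = j" for i j \<phi>
    by (auto simp: graph_def)
  show "\<phi> = \<psi>"
  proof (rule multiset_eqI)
    fix i show "count \<phi> i = count \<psi> i" using eq mem[of i _ \<phi>] mem[of i _ \<psi>] by (metis gr0I)
  qed
qed

lemma card_graph: "card (graph \<phi>) = mset_dimension \<phi>"
  unfolding graph_def mset_dimension_def by (rule card_image) (auto intro: inj_onI)

lemma graph_subset:
  assumes "\<phi> \<in> set_pmf profile_pmf" shows "graph \<phi> \<subseteq> {1..n} \<times> {1..n}"
proof -
  obtain xs :: "nat list" where xs: "length xs = n" "\<phi> = profile xs" using set_profile_pmf[OF assms] by blast
  have "i \<le> n" "i \<ge> 1" "count \<phi> i \<le> n" if i: "i \<in># \<phi>" for i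
  proof -
    obtain x where x: "x \<in> set xs" "i = count_list xs x" using i xs by (auto simp: set_mset_profile)
    thus "i \<le> n" "i \<ge> 1" using xs count_le_length[of xs] count_list_0_iff[of xs x]
      by (auto simp: Suc_le_eq)
    have "count \<phi> i \<le> card (set xs)" unfolding xs count_profile by (intro card_mono) auto
    thus "count \<phi> i \<le> n" using card_length[of xs] xs by simp
  qed
  thus ?thesis by (auto simp: graph_def Suc_le_eq)
qed

lemma finite_profile_pmf: "finite (set_pmf profile_pmf)"
proof (rule finite_imageD)
  have "graph ` set_pmf profile_pmf \<subseteq> Pow ({1..n} \<times> {1..n})" by (intro image_subsetI PowI graph_subset)
  thus "finite (graph ` set_pmf profile_pmf)" by (rule finite_subset) simp
  show "inj_on graph (set_pmf profile_pmf)" using inj_graph by (rule inj_on_subset) auto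
qed

lemma sum_profile_pmf: "(\<Sum>\<phi>\<in>set_pmf profile_pmf. pmf profile_pmf \<phi>) = 1"
  by (rule sum_pmf_eq_1[OF finite_profile_pmf order_refl])

lemma profile_entropy_eq_ent: "profile_entropy n p = ent"
proof -
  have "(\<Sum>\<^sub>\<infinity>\<phi>. pmf profile_pmf \<phi> * ln (pmf profile_pmf \<phi>)) = (\<Sum>\<phi>\<in>set_pmf profile_pmf. pmf profile_pmf \<phi> * ln (pmf profile_pmf \<phi>))"
    by (subst infsum_finite[symmetric, OF finite_profile_pmf], rule infsum_cong_neutral) (auto simp: set_pmf_iff)
  thus ?thesis unfolding profile_entropy_eq ent_def profile_pmf_def by (simp add: sum_negf)
qed

lemma ent_summand_nonneg: "0 \<le> pmf profile_pmf \<phi> * - ln (pmf profile_pmf \<phi>)"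
proof (cases "pmf profile_pmf \<phi> = 0")
  case False
  hence "ln (pmf profile_pmf \<phi>) \<le> 0" using pmf_le_1[of profile_pmf \<phi>] pmf_nonneg[of profile_pmf \<phi>] by simp
  thus ?thesis by (intro mult_nonneg_nonneg) auto
qed auto

lemma ent_nonneg: "ent \<ge> 0" unfolding ent_def by (intro sum_nonneg ent_summand_nonneg)

lemma sum_prob_profile:
  assumes "F \<subseteq> set_pmf profile_pmf"
  shows "(\<Sum>\<phi>\<in>F. measure_pmf.prob P {xs. profile xs = \<phi> \<and> Q xs}) = measure_pmf.prob P {xs. profile xs \<in> F \<and> Q xs}"
proof -
  have eq: "{xs. profile xs \<in> F \<and> Q xs} = (\<Union>\<phi>\<in>F. {xs. profile xs = \<phi> \<and> Q xs})" by blast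
  show ?thesis
    unfolding eq using finite_subset[OF assms finite_profile_pmf]
    by (intro measure_pmf.finite_measure_finite_Union[symmetric]) (auto simp: disjoint_family_on_def)
qed

lemma pmf_profile_pmf: "pmf profile_pmf \<phi> = measure_pmf.prob P {xs. profile xs = \<phi>}"
  by (simp add: profile_pmf_def pmf_map vimage_def)

text \<open>A profile more likely than \<open>exp (- X)\<close> gets at least half of its
  probability from samples that are not good. Such profiles have total mass at most
  \<open>8 / n <= 1 / 2\<close>; the others have mass at least 1/2 and information at least
  \<open>X\<close> each, so \<open>ent >= X / 2\<close>.\<close>

lemma ent_lower:
  assumes n: "n \<ge> 16" shows "mu \<le> 48 * ent + 144 * L"
proof -
  \<comment> \<open>The \<open>- 1\<close> pays for the factor 2 in \<open>bad\<close>, as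
    \<open>2 <= e\<close>.\<close>
  define X where "X = mu / 24 - 5 * L - 1"
  show ?thesis
  proof (cases "X \<le> 0")
    case True
    thus ?thesis using ent_nonneg L_ge_1 unfolding X_def by argo
  next
    case X: False
    define J where "J = {\<phi>\<in>set_pmf profile_pmf. pmf profile_pmf \<phi> \<le> exp (- X)}"
    have bad: "pmf profile_pmf \<phi> \<le> 2 * measure_pmf.prob P {xs. profile xs = \<phi> \<and> \<not> good xs}"
      if "\<phi> \<in> set_pmf profile_pmf - J" for \<phi>
    proof -
      have "2 * exp (5 * L - mu / 24) \<le> exp 1 * exp (5 * L - mu / 24)"
        using exp_ge_add_one_self[of 1] by (intro mult_right_mono) auto
      also have "\<dots> = exp (- X)" by (simp add: mult_exp_exp X_def algebra_simps)
      also have "\<dots> < pmf profile_pmf \<phi>" using that by (auto simp: J_def)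
      finally have "2 * measure_pmf.prob P {xs. profile xs = \<phi> \<and> good xs} \<le> pmf profile_pmf \<phi>"
        using prob_profile_good_le[of \<phi>] by linarith
      moreover have "pmf profile_pmf \<phi> = measure_pmf.prob P ({xs. profile xs = \<phi> \<and> good xs} \<union> {xs. profile xs = \<phi> \<and> \<not> good xs})"
        unfolding pmf_profile_pmf by (rule arg_cong[where f="measure_pmf.prob P"]) auto
      moreover have "\<dots> = measure_pmf.prob P {xs. profile xs = \<phi> \<and> good xs} + measure_pmf.prob P {xs. profile xs = \<phi> \<and> \<not> good xs}"
        by (rule measure_pmf.finite_measure_Union) auto
      ultimately show ?thesis by linarith
    qed
    have "(\<Sum>\<phi>\<in>set_pmf profile_pmf - J. pmf profile_pmf \<phi>) \<le> (\<Sum>\<phi>\<in>set_pmf profile_pmf - J. 2 * measure_pmf.prob P {xs. profile xs = \<phi> \<and> \<not> good xs})"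
      by (intro sum_mono bad)
    also have "\<dots> = 2 * measure_pmf.prob P {xs. profile xs \<in> set_pmf profile_pmf - J \<and> \<not> good xs}"
      by (simp add: sum_distrib_left[symmetric] sum_prob_profile)
    also have "\<dots> \<le> 2 * measure_pmf.prob P {xs. \<not> good xs}"
      by (intro mult_left_mono measure_pmf.finite_measure_mono) auto
    also have "\<dots> \<le> 2 * (4 / real n)" by (intro mult_left_mono prob_not_good) auto
    also have "\<dots> \<le> 1 / 2" using n by (simp add: field_simps)
    finally have "(\<Sum>\<phi>\<in>set_pmf profile_pmf - J. pmf profile_pmf \<phi>) \<le> 1 / 2" .
    moreover have "(\<Sum>\<phi>\<in>set_pmf profile_pmf - J. pmf profile_pmf \<phi>) = 1 - (\<Sum>\<phi>\<in>J. pmf profile_pmf \<phi>)"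
      using finite_profile_pmf by (subst sum_diff) (auto simp: J_def sum_profile_pmf)
    ultimately have "1 / 2 \<le> (\<Sum>\<phi>\<in>J. pmf profile_pmf \<phi>)" by linarith
    hence "1 / 2 * X \<le> (\<Sum>\<phi>\<in>J. pmf profile_pmf \<phi>) * X" using X by (intro mult_right_mono) auto
    also have "\<dots> = (\<Sum>\<phi>\<in>J. pmf profile_pmf \<phi> * X)" by (simp add: sum_distrib_right)
    also have "\<dots> \<le> (\<Sum>\<phi>\<in>J. pmf profile_pmf \<phi> * - ln (pmf profile_pmf \<phi>))"
    proof (intro sum_mono mult_left_mono)
      fix \<phi> assume "\<phi> \<in> J"
      hence "pmf profile_pmf \<phi> > 0" "pmf profile_pmf \<phi> \<le> exp (- X)" by (auto simp: J_def pmf_positive)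
      hence "ln (pmf profile_pmf \<phi>) \<le> - X" by (metis ln_exp ln_le_cancel_iff exp_gt_zero)
      thus "X \<le> - ln (pmf profile_pmf \<phi>)" by simp
    qed auto
    also have "\<dots> \<le> ent" unfolding ent_def
      using finite_profile_pmf ent_summand_nonneg by (intro sum_mono2) (auto simp: J_def)
    finally show ?thesis using L_ge_1 unfolding X_def by argo
  qed
qed

text \<open>A Kraft-type inequality: over all subsets of the grid the sum is
  \<open>(1 + 1 / n ^ 2) ^ (n ^ 2)\<close>, at most \<open>e\<close>.\<close>

lemma sum_dimension_weight_le:
  "(\<Sum>\<phi>\<in>set_pmf profile_pmf. (1 / real n ^ 2) ^ mset_dimension \<phi>) \<le> exp 1"
proof -
  let ?u = "1 / real n ^ 2" and ?B = "{1..n} \<times> {1..n}"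
  have "(\<Sum>\<phi>\<in>set_pmf profile_pmf. ?u ^ mset_dimension \<phi>) = (\<Sum>T\<in>graph ` set_pmf profile_pmf. ?u ^ card T)"
    using inj_graph by (subst sum.reindex) (auto simp: card_graph intro: inj_on_subset)
  also have "\<dots> \<le> (\<Sum>T\<in>Pow ?B. ?u ^ card T)"
  proof (rule sum_mono2)
    show "graph ` set_pmf profile_pmf \<subseteq> Pow ?B" by (intro image_subsetI PowI graph_subset)
  qed simp_all
  also have "\<dots> = (1 + ?u) ^ card ?B" by (rule prod_const_sum_Pow) auto
  also have "\<dots> \<le> exp ?u ^ card ?B" by (intro power_mono exp_ge_add_one_self) auto
  also have "\<dots> = exp (real (card ?B) * ?u)" by (rule exp_of_nat_mult[symmetric])
  also have "real (card ?B) * ?u = 1" using n_ge_1 by (simp add: power2_eq_square)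
  finally show ?thesis .
qed

text \<open>Good samples have dimension at most \<open>2 * mu + 42 * L\<close>. The others have
  dimension at most \<open>n\<close> and probability at most \<open>4 / n\<close>, which adds 4, and
  \<open>4 <= 4 * L\<close>.\<close>

lemma expected_dimension_le:
  "(\<Sum>\<phi>\<in>set_pmf profile_pmf. pmf profile_pmf \<phi> * real (mset_dimension \<phi>)) \<le> 2 * mu + 46 * L"
proof -
  let ?b = "2 * mu + 42 * L"
  define F where "F = {\<phi>\<in>set_pmf profile_pmf. real (mset_dimension \<phi>) > ?b}"
  have b: "?b \<ge> 0" using mu_nonneg L_ge_1 by linarith
  have "(\<Sum>\<phi>\<in>set_pmf profile_pmf. pmf profile_pmf \<phi> * real (mset_dimension \<phi>))
     \<le> (\<Sum>\<phi>\<in>set_pmf profile_pmf. pmf profile_pmf \<phi> * ?b + (if \<phi> \<in> F then pmf profile_pmf \<phi> * real n else 0))"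
  proof (intro sum_mono)
    fix \<phi> assume \<phi>: "\<phi> \<in> set_pmf profile_pmf"
    have "mset_dimension \<phi> \<le> n" using set_profile_pmf[OF \<phi>] mset_dimension_profile_le by blast
    hence "real (mset_dimension \<phi>) \<le> ?b + (if \<phi> \<in> F then real n else 0)"
      using \<phi> b by (auto simp: F_def)
    hence "pmf profile_pmf \<phi> * real (mset_dimension \<phi>) \<le> pmf profile_pmf \<phi> * (?b + (if \<phi> \<in> F then real n else 0))"
      by (intro mult_left_mono) auto
    thus "pmf profile_pmf \<phi> * real (mset_dimension \<phi>) \<le> pmf profile_pmf \<phi> * ?b + (if \<phi> \<in> F then pmf profile_pmf \<phi> * real n else 0)"
      by (auto simp: algebra_simps)
  qed
  also have "\<dots> = ?b + (\<Sum>\<phi>\<in>F. pmf profile_pmf \<phi>) * real n"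
  proof -
    have "set_pmf profile_pmf \<inter> F = F" by (auto simp: F_def)
    thus ?thesis using finite_profile_pmf
      by (simp add: sum.distrib sum.If_cases sum_distrib_right[symmetric] sum_profile_pmf)
  qed
  also have "(\<Sum>\<phi>\<in>F. pmf profile_pmf \<phi>) = measure_pmf.prob P {xs. profile xs \<in> F}"
    using sum_prob_profile[of F "\<lambda>_. True"] by (auto simp: F_def pmf_profile_pmf)
  also have "\<dots> \<le> measure_pmf.prob P {xs. \<not> good xs}"
    using dimension_le length_P by (intro prob_mono_set_pmf) (force simp: F_def)
  also have "\<dots> \<le> 4 / real n" by (rule prob_not_good)
  also have "4 / real n * real n = 4" using n_ge_1 by simp
  finally show ?thesis using L_ge_1 n_ge_1 by (simp add: mult_right_mono)
qed

text \<open>Gibbs' inequality against the weights \<open>w\<close>, which have total mass at most 1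
  by \<open>sum_dimension_weight_le\<close>. Their logarithms are affine in the dimension.\<close>

lemma ent_upper: "ent \<le> 1 + 2 * L * (2 * mu + 46 * L)"
proof -
  define w where "w \<phi> = exp (-1) * (1 / real n ^ 2) ^ mset_dimension \<phi>" for \<phi> :: "nat multiset"
  have w: "w \<phi> > 0" for \<phi> using n_ge_1 by (simp add: w_def)
  have lnw: "- ln (w \<phi>) = 1 + 2 * ln (real n) * real (mset_dimension \<phi>)" for \<phi>
    using n_ge_1 by (simp add: w_def ln_mult ln_realpow ln_div)
  have "ent - (\<Sum>\<phi>\<in>set_pmf profile_pmf. pmf profile_pmf \<phi> * - ln (w \<phi>)) = (\<Sum>\<phi>\<in>set_pmf profile_pmf. pmf profile_pmf \<phi> * ln (w \<phi> / pmf profile_pmf \<phi>))"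
    unfolding ent_def sum_subtractf[symmetric]
    using w by (intro sum.cong) (auto simp: ln_div pmf_positive algebra_simps less_imp_neq[THEN not_sym])
  also have "\<dots> \<le> (\<Sum>\<phi>\<in>set_pmf profile_pmf. w \<phi> - pmf profile_pmf \<phi>)"
  proof (intro sum_mono)
    fix \<phi> assume \<phi>: "\<phi> \<in> set_pmf profile_pmf"
    hence pos: "pmf profile_pmf \<phi> > 0" by (rule pmf_positive)
    have "ln (w \<phi> / pmf profile_pmf \<phi>) \<le> w \<phi> / pmf profile_pmf \<phi> - 1" using w pos by (intro ln_le_minus_one) auto
    hence "pmf profile_pmf \<phi> * ln (w \<phi> / pmf profile_pmf \<phi>) \<le> pmf profile_pmf \<phi> * (w \<phi> / pmf profile_pmf \<phi> - 1)" using pos by simp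
    thus "pmf profile_pmf \<phi> * ln (w \<phi> / pmf profile_pmf \<phi>) \<le> w \<phi> - pmf profile_pmf \<phi>" using pos by (simp add: algebra_simps)
  qed
  also have "\<dots> = exp (-1) * (\<Sum>\<phi>\<in>set_pmf profile_pmf. (1 / real n ^ 2) ^ mset_dimension \<phi>) - 1"
    by (simp add: w_def sum_subtractf sum_profile_pmf sum_distrib_left)
  also have "\<dots> \<le> exp (-1) * exp 1 - 1"
    by (intro diff_right_mono mult_left_mono sum_dimension_weight_le) auto
  also have "\<dots> = 0" by (simp add: mult_exp_exp)
  finally have "ent \<le> (\<Sum>\<phi>\<in>set_pmf profile_pmf. pmf profile_pmf \<phi> * - ln (w \<phi>))" by simp
  also have "\<dots> = 1 + 2 * ln (real n) * (\<Sum>\<phi>\<in>set_pmf profile_pmf. pmf profile_pmf \<phi> * real (mset_dimension \<phi>))"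
    by (simp only: lnw) (simp add: distrib_left sum.distrib sum_profile_pmf sum_distrib_left mult_ac)
  also have "\<dots> \<le> 1 + 2 * L * (2 * mu + 46 * L)"
    using n_ge_1 by (intro add_left_mono mult_mono expected_dimension_le) (auto simp: L_def intro!: sum_nonneg)
  finally show ?thesis .
qed

section \<open>Combining the bounds\<close>

lemma tilde_Theta_good:
  assumes "length xs = n" "good xs" "n \<ge> 16"
  shows "tilde_Theta 426 n (next_int (profile_entropy n p)) (mset_dimension (profile xs))"
proof -
  define D where "D = real (mset_dimension (profile xs))"
  define A where "A = real_of_int (next_int ent)"
  have "\<lfloor>ent\<rfloor> \<ge> 0" using ent_nonneg by simp
  \<comment> \<open>\<open>A >= 1\<close> holds even for zero entropy and lets the additive terms in
    \<open>L\<close> be absorbed into \<open>L * A\<close>.\<close>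
  hence A: "A \<le> ent + 1" "A \<ge> ent" "A \<ge> 1" unfolding A_def next_int_eq by linarith+
  have "xs \<noteq> []" using assms by auto
  hence D1: "D \<ge> 1" using mset_dimension_profile_pos unfolding D_def by force
  have LD: "L * D \<ge> 0" "L * A \<ge> A" using L_ge_1 D1 A by auto
  \<comment> \<open>Only powers of \<open>L\<close> up to 2 arise; the exponent 426 appears because
    \<open>tilde_Theta\<close> uses one constant for both roles. It is \<open>96 + 330\<close> from
    the lower bound.\<close>
  have LL: "L ^ 2 \<le> L powr 426"
    using L_ge_1 powr_mono[of 2 426 L] by simp
  have L2: "L \<le> L ^ 2" "1 \<le> L ^ 2" using L_ge_1 by (auto intro: self_le_power)
  have "D \<le> 2 * (48 * ent + 144 * L) + 42 * L"
    using dimension_le[OF assms(1,2)] ent_lower[OF assms(3)] by (simp add: D_def)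
  also have "\<dots> = 96 * ent + 330 * L" by simp
  also have "\<dots> \<le> 96 * (L * A) + 330 * (L * A)"
  proof (intro add_mono mult_left_mono)
    show "ent \<le> L * A" using A LD by linarith
    show "L \<le> L * A" using A L_ge_1 by simp
  qed simp_all
  also have "\<dots> = (426 * L) * A" by simp
  also have "\<dots> \<le> (426 * L powr 426) * A" using A L2 LL by (intro mult_right_mono) auto
  finally have 1: "D / (426 * L powr 426) \<le> A"
    using L_ge_1 by (simp add: field_simps)
  have "A \<le> 2 + 2 * L * (2 * mu + 46 * L)" using A ent_upper by linarith
  also have "\<dots> \<le> 2 + 2 * L * (2 * (6 * L * D) + 46 * L)"
    using mu_le[OF assms(1,2)] L_ge_1 unfolding D_def by (intro add_left_mono mult_left_mono add_right_mono) auto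
  also have "\<dots> = 2 + 24 * (L ^ 2 * D) + 92 * L ^ 2" by (simp add: power2_eq_square algebra_simps)
  also have "\<dots> \<le> 118 * (L ^ 2 * D)"
  proof -
    have "L ^ 2 * 1 \<le> L ^ 2 * D" using D1 by (intro mult_left_mono) auto
    thus ?thesis using L2 by linarith
  qed
  also have "\<dots> \<le> 426 * (L powr 426 * D)" using LL D1 by (intro mult_mono) auto
  finally have 2: "A \<le> 426 * L powr 426 * D" by simp
  show ?thesis using 1 2 unfolding tilde_Theta_def profile_entropy_eq_ent A_def D_def L_def by simp
qed

lemma entropy_dimension_whp_nat: "entropy_dimension_whp 426 4 n p"
proof (cases "n \<ge> 16")
  case True
  let ?T = "{xs. tilde_Theta 426 n (next_int (profile_entropy n p)) (mset_dimension (profile xs))}"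
  have "1 - 4 / sqrt (real n) \<le> 1 - 4 / real n"
  proof -
    have "sqrt (real n) \<le> sqrt (real n ^ 2)"
      using True by (intro real_sqrt_le_mono self_le_power) auto
    thus ?thesis using True by (intro diff_left_mono divide_left_mono) auto
  qed
  also have "\<dots> \<le> 1 - measure_pmf.prob P {xs. \<not> good xs}" using prob_not_good by simp
  also have "\<dots> = measure_pmf.prob P {xs. good xs}"
    by (subst measure_pmf.prob_compl[symmetric]) (auto intro!: arg_cong[where f="measure_pmf.prob P"])
  also have "\<dots> \<le> measure_pmf.prob P ?T"
    using True length_P by (intro prob_mono_set_pmf) (auto intro: tilde_Theta_good)
  finally show ?thesis by (simp add: entropy_dimension_whp_def)
next
  case False
  \<comment> \<open>For \<open>n < 16\<close> the constant 4 makes the claimed probability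
    nonpositive.\<close>
  have "sqrt (real n) \<le> sqrt (4 ^ 2)" using False by (intro real_sqrt_le_mono) auto
  hence "1 - 4 / sqrt (real n) \<le> 0" using n_ge_1 by (simp add: field_simps)
  thus ?thesis unfolding entropy_dimension_whp_def by (rule order_trans) auto
qed

end

subsection \<open>Change of alphabet\<close>

lemma profile_map_inj:
  assumes "inj_on f (set xs)" shows "profile (map f xs) = profile xs"
proof -
  have "image_mset (count_list (map f xs)) (mset_set (f ` set xs)) = 
        image_mset (count_list (map f xs) \<circ> f) (mset_set (set xs))"
    using assms by (simp add: image_mset_mset_set[symmetric] multiset.map_comp)
  also have "\<dots> = image_mset (count_list xs) (mset_set (set xs))"
    using assms by (intro image_mset_cong) (auto simp: count_list_inj_map)
  finally show ?thesis by (simp add: profile_def)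
qed

lemma map_pmf_profile_map:
  assumes "inj_on f (set_pmf p)"
  shows "map_pmf profile (replicate_pmf n (map_pmf f p)) = map_pmf profile (replicate_pmf n p)"
proof -
  have "replicate_pmf n (map_pmf f p) = map_pmf (map f) (replicate_pmf n p)"
    by (induction n) (simp_all add: map_pmf_def bind_assoc_pmf bind_return_pmf)
  hence "map_pmf profile (replicate_pmf n (map_pmf f p)) = map_pmf (\<lambda>xs. profile (map f xs)) (replicate_pmf n p)"
    by (simp add: pmf.map_comp comp_def)
  also have "\<dots> = map_pmf profile (replicate_pmf n p)"
    using assms by (intro map_pmf_cong refl profile_map_inj) (auto simp: set_replicate_pmf intro: inj_on_subset)
  finally show ?thesis .
qed

text \<open>Entropy and dimension depend on the sample only through the law of its profile, which is
  invariant under relabelling the support injectively.\<close>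

lemma entropy_dimension_whp_map:
  assumes "inj_on f (set_pmf p)"
  shows "entropy_dimension_whp C c n (map_pmf f p) \<longleftrightarrow> entropy_dimension_whp C c n p"
proof -
  have ent: "profile_entropy n (map_pmf f p) = profile_entropy n p"
    unfolding profile_entropy_eq map_pmf_profile_map[OF assms] ..
  have prob: "measure_pmf.prob (replicate_pmf n (map_pmf f p)) {xs. R (profile xs)} =
      measure_pmf.prob (replicate_pmf n p) {xs. R (profile xs)}" for R
    using arg_cong[OF map_pmf_profile_map[OF assms, of n], of "\<lambda>q. measure_pmf.prob q {\<phi>. R \<phi>}"]
    by (simp add: vimage_def)
  show ?thesis
    unfolding entropy_dimension_whp_def ent
    using prob[of "\<lambda>\<phi>. tilde_Theta C n (next_int (profile_entropy n p)) (mset_dimension \<phi>)"] by simp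
qed

theorem theorem1:
  shows "(\<exists>C>0. \<exists>c>0. \<forall>(p :: nat pmf) n. n \<ge> 1 \<longrightarrow> entropy_dimension_whp C c n p) \<and>
         (\<forall>C>0. \<forall>c>0. (\<forall>(p :: nat pmf) n. n \<ge> 1 \<longrightarrow> entropy_dimension_whp C c n p) \<longrightarrow>
            (\<forall>(p :: 'a pmf) n. n \<ge> 1 \<longrightarrow> entropy_dimension_whp C c n p))"
proof (intro conjI allI impI)
  have "\<forall>(p :: nat pmf) n. n \<ge> 1 \<longrightarrow> entropy_dimension_whp 426 4 n p"
    by (intro allI impI iid_sample.entropy_dimension_whp_nat iid_sample.intro)
  thus "\<exists>C>0. \<exists>c>0. \<forall>(p :: nat pmf) n. n \<ge> 1 \<longrightarrow> entropy_dimension_whp C c n p"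
    by (intro exI[of _ "426 :: real"] conjI exI[of _ "4 :: real"]) simp_all
next
  fix C c :: real and p :: "'a pmf" and n :: nat
  assume nat: "\<forall>(p :: nat pmf) n. n \<ge> 1 \<longrightarrow> entropy_dimension_whp C c n p" and n: "n \<ge> 1"
  \<comment> \<open>The support of a \<open>pmf\<close> is countable, so it can be relabelled by
    natural numbers.\<close>
  have "inj_on (to_nat_on (set_pmf p)) (set_pmf p)" by (rule inj_on_to_nat_on) auto
  thus "entropy_dimension_whp C c n p"
    using nat n entropy_dimension_whp_map by blast
qed

end
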